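(* Let $n$ be odd and let $G$ be a finite connected graph with a harmonic action of $D_n=\langle\sigma_1,\sigma_2\rangle$ as described in the context, with vertices labeled $z_i^j$ ($1\le j\le s$) and $x_i^j,y_i^j$ ($1\le j\le t$), $i\in\{1,\dots,n\}$. Let $\delta$ be a divisor of degree zero on $G$. Then $\delta\in\mathcal{P}=\mathcal{P}_1+\mathcal{P}_2+\mathcal{P}_3$ if and only if: (1) $\sum_{i=1}^n i\,(X_i+Y_i+Z_i)\equiv 0\pmod n$, where $X_i=\sum_{j=1}^t\delta(x_i^j)$, $Y_i=\sum_{j=1}^t\delta(y_i^j)$, $Z_i=\sum_{j=1}^s\delta(z_i^j)$; and (2) for each $j=1,\dots,t$, $\sum_{i=1}^n\delta(x_i^j)\equiv\sum_{i=1}^n\delta(y_i^j)\pmod n$.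
   Context: Graphs are finite, connected, may have multiple edges, no loops. A divisor on $G$ is a function from the vertex set to $\mathbb{Z}$; its degree is the sum of its values. Setting: $D_n$ is the dihedral group of order $2n$ generated by involutions $\sigma_1,\sigma_2$, acting on $G$ by automorphisms harmonically (no non-identity element fixes both endpoints of an edge), and every $D_n$-orbit of vertices has $n$ or $2n$ points. The vertices are labeled so that there are $s$ orbits of size $n$, $\{z_i^j: i=1,\dots,n\}$ for $j=1,\dots,s$, and $t$ orbits of size $2n$, $\{x_i^j,y_i^j\}$ for $j=1,\dots,t$, with (subscripts mod $n$) $\sigma_1(z_i^j)=z_{n+1-i}^j$, $\sigma_1(x_i^j)=y_{n+1-i}^j$, $\sigma_1(y_i^j)=x_{n+1-i}^j$, $\sigma_2(z_i^j)=z_{n+2-i}^j$, $\sigma_2(x_i^j)=y_{n+2-i}^j$, $\sigma_2(y_i^j)=x_{n+2-i}^j$. For a subgroup $\Gamma$ the quotient graph $G/\Gamma$ has vertices the $\Gamma$-orbits of vertices and edges the $\Gamma$-orbits of edges, quotient map $\phi$; the pullback of a divisor $\hat D$ on $G/\Gamma$ is $\phi^*(\hat D)(v)=|\mathrm{Stab}_\Gamma(v)|\,\hat D(\phi(v))$. Let $H_1=G/\langle\sigma_1\rangle$, $H_2=G/\langle\sigma_2\rangle$, $H_3=G/\langle\sigma_1\sigma_2\rangle$, let $\mathcal{P}_k$ be the set of divisors $\phi_k^*(\hat D)$ with $\hat D$ of degree zero on $H_k$, and $\mathcal{P}_1+\mathcal{P}_2+\mathcal{P}_3$ the set of sums $\delta_1+\delta_2+\delta_3$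 with $\delta_k\in\mathcal{P}_k$. *)

theory Defs
  imports
    "HOL-Algebra.Group_Action"
    "HOL-Algebra.Elementary_Groups"
    "HOL-Number_Theory.Cong"
begin

text \<open>
  Undirected graphs with possible multiple edges: each edge is sent to the set of its endpoints.
  A loop would be an edge whose set of endpoints is a singleton; the record type itself admits
  these, because they can arise in a quotient.
\<close>

record ('v, 'e) multigraph =
  verts :: "'v set"
  edges :: "'e set"
  ends :: "'e \<Rightarrow> 'v set"

definition adj_rel :: "('v, 'e) multigraph \<Rightarrow> 'v rel" where
  "adj_rel G = {(u, v). \<exists>e\<in>edges G. ends G e = {u, v}}"

definition connected_graph :: "('v, 'e) multigraph \<Rightarrow> bool" where
  "connected_graph G \<longleftrightarrow>
     verts G \<noteq> {} \<and> (\<forall>u\<in>verts G. \<forall>v\<in>verts G. (u, v) \<in> (adj_rel G)\<^sup>*)"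

definition finite_loopless_graph :: "('v, 'e) multigraph \<Rightarrow> bool" where
  "finite_loopless_graph G \<longleftrightarrow>
     finite (verts G) \<and> finite (edges G) \<and>
     (\<forall>e\<in>edges G. ends G e \<subseteq> verts G \<and> card (ends G e) = 2)"

definition graph_action ::
  "('g, 'm) monoid_scheme \<Rightarrow> ('v, 'e) multigraph \<Rightarrow> ('g \<Rightarrow> 'v \<Rightarrow> 'v) \<Rightarrow> ('g \<Rightarrow> 'e \<Rightarrow> 'e) \<Rightarrow> bool"
where
  "graph_action \<Gamma> G \<phi> \<psi> \<longleftrightarrow>
     group_action \<Gamma> (verts G) \<phi> \<and> group_action \<Gamma> (edges G) \<psi> \<and>
     (\<forall>g\<in>carrier \<Gamma>. \<forall>e\<in>edges G. ends G (\<psi> g e) = \<phi> g ` ends G e)"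

definition harmonic_action ::
  "('g, 'm) monoid_scheme \<Rightarrow> ('v, 'e) multigraph \<Rightarrow> ('g \<Rightarrow> 'v \<Rightarrow> 'v) \<Rightarrow> ('g \<Rightarrow> 'e \<Rightarrow> 'e) \<Rightarrow> bool"
where
  "harmonic_action \<Gamma> G \<phi> \<psi> \<longleftrightarrow>
     graph_action \<Gamma> G \<phi> \<psi> \<and>
     (\<forall>g\<in>carrier \<Gamma>. \<forall>e\<in>edges G. (\<forall>v\<in>ends G e. \<phi> g v = v) \<longrightarrow> g = \<one>\<^bsub>\<Gamma>\<^esub>)"

definition dihedral_group :: "('g, 'm) monoid_scheme \<Rightarrow> nat \<Rightarrow> 'g \<Rightarrow> 'g \<Rightarrow> bool" where
  "dihedral_group D n \<sigma>\<^sub>1 \<sigma>\<^sub>2 \<longleftrightarrow>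
     group D \<and> order D = 2 * n \<and>
     \<sigma>\<^sub>1 \<in> carrier D \<and> \<sigma>\<^sub>1 \<noteq> \<one>\<^bsub>D\<^esub> \<and> \<sigma>\<^sub>1 \<otimes>\<^bsub>D\<^esub> \<sigma>\<^sub>1 = \<one>\<^bsub>D\<^esub> \<and>
     \<sigma>\<^sub>2 \<in> carrier D \<and> \<sigma>\<^sub>2 \<noteq> \<one>\<^bsub>D\<^esub> \<and> \<sigma>\<^sub>2 \<otimes>\<^bsub>D\<^esub> \<sigma>\<^sub>2 = \<one>\<^bsub>D\<^esub> \<and>
     generate D {\<sigma>\<^sub>1, \<sigma>\<^sub>2} = carrier D"

text \<open>
  The endpoints of an edge orbit are the orbits of the endpoints of any of its members; the union
  over all members avoids choosing a representative.
\<close>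

definition quotient_graph ::
  "('g, 'm) monoid_scheme \<Rightarrow> ('v, 'e) multigraph \<Rightarrow> ('g \<Rightarrow> 'v \<Rightarrow> 'v) \<Rightarrow> ('g \<Rightarrow> 'e \<Rightarrow> 'e)
     \<Rightarrow> ('v set, 'e set) multigraph"
where
  "quotient_graph \<Gamma> G \<phi> \<psi> =
     \<lparr>verts = orbits \<Gamma> (verts G) \<phi>,
      edges = orbits \<Gamma> (edges G) \<psi>,
      ends = (\<lambda>E. orbit \<Gamma> \<phi> ` (\<Union>e\<in>E. ends G e))\<rparr>"

text \<open>
  A function on the vertex set is represented by its extension by zero, so that equality of
  divisors is equality of functions.
\<close>

definition divisors :: "('v, 'e) multigraph \<Rightarrow> ('v \<Rightarrow> int) set" where
  "divisors G = {\<delta>. \<forall>v. v \<notin> verts G \<longrightarrow> \<delta> v = 0}"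

definition divisor_degree :: "('v, 'e) multigraph \<Rightarrow> ('v \<Rightarrow> int) \<Rightarrow> int" where
  "divisor_degree G \<delta> = (\<Sum>v\<in>verts G. \<delta> v)"

definition pullback ::
  "('g, 'm) monoid_scheme \<Rightarrow> ('v, 'e) multigraph \<Rightarrow> ('g \<Rightarrow> 'v \<Rightarrow> 'v) \<Rightarrow> ('v set \<Rightarrow> int) \<Rightarrow> 'v \<Rightarrow> int"
where
  "pullback \<Gamma> G \<phi> \<delta> =
     (\<lambda>v. if v \<in> verts G then int (card (stabilizer \<Gamma> \<phi> v)) * \<delta> (orbit \<Gamma> \<phi> v) else 0)"

definition pullbacks_deg0 ::
  "('g, 'm) monoid_scheme \<Rightarrow> ('v, 'e) multigraph \<Rightarrow> ('g \<Rightarrow> 'v \<Rightarrow> 'v) \<Rightarrow> ('g \<Rightarrow> 'e \<Rightarrow> 'e)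
     \<Rightarrow> ('v \<Rightarrow> int) set"
where
  "pullbacks_deg0 \<Gamma> G \<phi> \<psi> =
     {pullback \<Gamma> G \<phi> \<delta> | \<delta>.
        \<delta> \<in> divisors (quotient_graph \<Gamma> G \<phi> \<psi>) \<and>
        divisor_degree (quotient_graph \<Gamma> G \<phi> \<psi>) \<delta> = 0}"

definition pullback_sum ::
  "('g, 'm) monoid_scheme \<Rightarrow> 'g \<Rightarrow> 'g \<Rightarrow> ('v, 'e) multigraph \<Rightarrow> ('g \<Rightarrow> 'v \<Rightarrow> 'v) \<Rightarrow> ('g \<Rightarrow> 'e \<Rightarrow> 'e)
     \<Rightarrow> ('v \<Rightarrow> int) set"
where
  "pullback_sum D \<sigma>\<^sub>1 \<sigma>\<^sub>2 G \<phi> \<psi> =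
     {(\<lambda>v. \<delta>\<^sub>1 v + \<delta>\<^sub>2 v + \<delta>\<^sub>3 v) | \<delta>\<^sub>1 \<delta>\<^sub>2 \<delta>\<^sub>3.
        \<delta>\<^sub>1 \<in> pullbacks_deg0 (subgroup_generated D {\<sigma>\<^sub>1}) G \<phi> \<psi> \<and>
        \<delta>\<^sub>2 \<in> pullbacks_deg0 (subgroup_generated D {\<sigma>\<^sub>2}) G \<phi> \<psi> \<and>
        \<delta>\<^sub>3 \<in> pullbacks_deg0 (subgroup_generated D {\<sigma>\<^sub>1 \<otimes>\<^bsub>D\<^esub> \<sigma>\<^sub>2}) G \<phi> \<psi>}"

text \<open>
  Subscripts modulo \<open>n\<close> are integers, with labels periodic of period \<open>n\<close> in the subscript. That the
  \<open>n\<close> (resp. \<open>2n\<close>) labels of an orbit are distinct is contained in the cardinalities of the orbits.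
\<close>

definition dihedral_labelling ::
  "('g, 'm) monoid_scheme \<Rightarrow> nat \<Rightarrow> 'g \<Rightarrow> 'g \<Rightarrow> ('v, 'e) multigraph \<Rightarrow> ('g \<Rightarrow> 'v \<Rightarrow> 'v)
     \<Rightarrow> nat \<Rightarrow> nat \<Rightarrow> (int \<Rightarrow> nat \<Rightarrow> 'v) \<Rightarrow> (int \<Rightarrow> nat \<Rightarrow> 'v) \<Rightarrow> (int \<Rightarrow> nat \<Rightarrow> 'v) \<Rightarrow> bool"
where
  "dihedral_labelling D n \<sigma>\<^sub>1 \<sigma>\<^sub>2 G \<phi> s t z x y \<longleftrightarrow>
     bij_betw (\<lambda>j. {z i j | i. i \<in> {1..int n}})
       {1..s} {B \<in> orbits D (verts G) \<phi>. card B = n} \<and>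
     bij_betw (\<lambda>j. {x i j | i. i \<in> {1..int n}} \<union> {y i j | i. i \<in> {1..int n}})
       {1..t} {B \<in> orbits D (verts G) \<phi>. card B = 2 * n} \<and>
     (\<forall>j\<in>{1..s}. \<forall>i.
        z (i + int n) j = z i j \<and>
        \<phi> \<sigma>\<^sub>1 (z i j) = z (int n + 1 - i) j \<and>
        \<phi> \<sigma>\<^sub>2 (z i j) = z (int n + 2 - i) j) \<and>
     (\<forall>j\<in>{1..t}. \<forall>i.
        x (i + int n) j = x i j \<and> y (i + int n) j = y i j \<and>
        \<phi> \<sigma>\<^sub>1 (x i j) = y (int n + 1 - i) j \<and> \<phi> \<sigma>\<^sub>1 (y i j) = x (int n + 1 - i) j \<and>
        \<phi> \<sigma>\<^sub>2 (x i j) = y (int n + 2 - i) j \<and> \<phi> \<sigma>\<^sub>2 (y i j) = x (int n + 2 - i) j)"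

end

theory Submission
  imports Defs "HOL-Library.Function_Algebras" "HOL-Library.Periodic_Fun"
begin

text \<open>
  Let the weight of a divisor \<open>f\<close> be the left-hand side of condition (1). The reflection \<open>\<sigma>\<^sub>k\<close> sends
  the index \<open>i\<close> to \<open>k - i\<close>, so if \<open>f\<close> is \<open>\<sigma>\<^sub>k\<close>-invariant, then twice its weight is \<open>k\<close> times its
  degree modulo \<open>n\<close>. Since \<open>n\<close> is odd, a pullback of a divisor of degree \<open>d\<close> on \<open>H\<^sub>1\<close>, \<open>H\<^sub>2\<close>, \<open>H\<^sub>3\<close> has
  weight \<open>d\<close>, \<open>2d\<close>, \<open>0\<close>. This gives necessity.

  For sufficiency, condition (2) alone makes \<open>\<delta>\<close> a sum of three pullbacks of divisors of arbitrary
  degrees: such sums include all differences \<open>x\<^sub>i - x\<^sub>k\<close>, all sums \<open>x\<^sub>i + y\<^sub>k\<close>, all multiples \<open>n x\<^sub>i\<close>, and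
  every \<open>z\<^sub>i\<close>, because \<open>n z\<^sub>i\<close> and \<open>2 z\<^sub>i\<close> are among them. If the three degrees are \<open>d\<^sub>1, d\<^sub>2, d\<^sub>3\<close>, then
  \<open>2 d\<^sub>1 + 2 d\<^sub>2 + n d\<^sub>3 = 0\<close> and, by (1), \<open>n\<close> divides \<open>d\<^sub>1 + 2 d\<^sub>2\<close>; hence \<open>n\<close> divides \<open>d\<^sub>1\<close> and \<open>d\<^sub>2\<close>, and
  \<open>d\<^sub>3\<close> is even. The sum of all \<open>D\<^sub>n\<close>-translates of a vertex is a pullback of a divisor of degree
  \<open>n\<close>, \<open>n\<close>, \<open>2\<close> on \<open>H\<^sub>1\<close>, \<open>H\<^sub>2\<close>, \<open>H\<^sub>3\<close>, so moving multiples of it between the summands makes all three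
  degrees vanish.
\<close>


section \<open>Periodic functions and congruences\<close>

lemma periodic_fun_cong:
  fixes f :: "int \<Rightarrow> 'a"
  assumes "periodic_fun_simple f m" and "[i = k] (mod m)"
  shows "f i = f k"
proof -
  interpret periodic_fun_simple f m by fact
  obtain c where "k = i + m * c" using assms(2) by (auto simp: cong_iff_lin)
  then show ?thesis using plus_of_int[of i c] by (simp add: mult.commute)
qed

definition residue :: "int \<Rightarrow> int \<Rightarrow> int" where
  "residue m i = (i - 1) mod m + 1"

lemma residue_in_range: "m > 0 \<Longrightarrow> residue m i \<in> {1..m}"
  by (simp add: residue_def add1_zle_eq)

lemma cong_residue: "[residue m i = i] (mod m)"
  by (simp add: residue_def cong_def mod_simps)

lemma residue_eqI:
  assumes "k \<in> {1..m}" and "[k = i] (mod m)"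
  shows "residue m i = k"
proof -
  have "(i - 1) mod m = (k - 1) mod m"
    using cong_diff[OF cong_sym[OF assms(2)] cong_refl] by (simp add: cong_def)
  then show ?thesis using assms(1) by (simp add: residue_def)
qed

lemma periodic_fun_residue:
  fixes f :: "int \<Rightarrow> 'a"
  assumes "periodic_fun_simple f m"
  shows "f (residue m i) = f i"
  by (rule periodic_fun_cong[OF assms cong_residue])

lemma sum_periodic_reflect:
  fixes f :: "int \<Rightarrow> 'a :: comm_monoid_add"
  assumes "periodic_fun_simple f m" and "m > 0"
  shows "(\<Sum>i=1..m. f (c - i)) = (\<Sum>i=1..m. f i)"
proof (rule sum.reindex_bij_witness[where i="\<lambda>i. residue m (c - i)" and j="\<lambda>i. residue m (c - i)"])
  fix i assume i: "i \<in> {1..m}"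
  show "residue m (c - residue m (c - i)) = i"
  proof (rule residue_eqI[OF i])
    show "[i = c - residue m (c - i)] (mod m)"
      using cong_diff[OF cong_refl[of c] cong_residue[of m "c - i"]] by (simp add: cong_sym)
  qed
  then show "residue m (c - residue m (c - i)) = i" .
  show "residue m (c - i) \<in> {1..m}" by (rule residue_in_range[OF \<open>m > 0\<close>])
  then show "residue m (c - i) \<in> {1..m}" .
  show "f (residue m (c - i)) = f (c - i)" by (rule periodic_fun_residue[OF assms(1)])
qed

definition moment :: "int \<Rightarrow> (int \<Rightarrow> int) \<Rightarrow> int" where
  "moment m f = (\<Sum>i=1..m. i * f i)"

lemma moment_reflect:
  assumes f: "periodic_fun_simple f m" and "m > 0"
  shows "[moment m (\<lambda>i. f (c - i)) + moment m f = c * (\<Sum>i=1..m. f i)] (mod m)"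
proof -
  let ?g = "\<lambda>i. (i mod m) * f i"
  have g: "periodic_fun_simple ?g m"
    using f by (simp add: periodic_fun_simple_def)
  have mod_cong: "[(\<Sum>i\<in>I. h i * k i) = (\<Sum>i\<in>I. (h i mod m) * k i)] (mod m)" for h k and I :: "int set"
    by (intro cong_sum cong_mult) (simp_all add: cong_def)
  have "[moment m f = (\<Sum>i=1..m. ?g i)] (mod m)"
    unfolding moment_def by (rule mod_cong)
  also have "(\<Sum>i=1..m. ?g i) = (\<Sum>i=1..m. ?g (c - i))"
    by (rule sum_periodic_reflect[OF g \<open>m > 0\<close>, symmetric])
  also have "[(\<Sum>i=1..m. ?g (c - i)) = (\<Sum>i=1..m. (c - i) * f (c - i))] (mod m)"
    by (rule mod_cong[THEN cong_sym])
  finally have "[moment m (\<lambda>i. f (c - i)) + moment m f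
      = moment m (\<lambda>i. f (c - i)) + (\<Sum>i=1..m. (c - i) * f (c - i))] (mod m)"
    by (intro cong_add cong_refl)
  also have "moment m (\<lambda>i. f (c - i)) + (\<Sum>i=1..m. (c - i) * f (c - i)) = c * (\<Sum>i=1..m. f (c - i))"
    by (simp add: moment_def left_diff_distrib sum_subtractf sum_distrib_left)
  also have "(\<Sum>i=1..m. f (c - i)) = (\<Sum>i=1..m. f i)"
    by (rule sum_periodic_reflect[OF f \<open>m > 0\<close>])
  finally show ?thesis .
qed

lemma cong_double_iff:
  fixes a b m :: int
  assumes "odd m"
  shows "[2 * a = 2 * b] (mod m) \<longleftrightarrow> [a = b] (mod m)"
  using assms by (intro cong_mult_lcancel) simp

lemma degree_equations_solution:
  fixes m d\<^sub>1 d\<^sub>2 d\<^sub>3 :: int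
  assumes "odd m" and degree: "2 * d\<^sub>1 + 2 * d\<^sub>2 + m * d\<^sub>3 = 0" and weight: "[d\<^sub>1 + 2 * d\<^sub>2 = 0] (mod m)"
  obtains k\<^sub>1 k\<^sub>2 where "d\<^sub>1 = m * k\<^sub>1" "d\<^sub>2 = m * k\<^sub>2" "d\<^sub>3 = - 2 * (k\<^sub>1 + k\<^sub>2)"
proof -
  obtain k where k: "d\<^sub>1 + 2 * d\<^sub>2 = m * k" using weight by (auto simp: cong_0_iff)
  have d\<^sub>1: "d\<^sub>1 = m * (- d\<^sub>3 - k)" using degree k by (simp add: algebra_simps)
  have "2 * d\<^sub>2 = m * (2 * k + d\<^sub>3)" using degree k by (simp add: algebra_simps)
  then have "m dvd 2 * d\<^sub>2" by simp
  then have "m dvd d\<^sub>2" using \<open>odd m\<close> by (simp add: coprime_dvd_mult_right_iff)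
  then obtain k\<^sub>2 where d\<^sub>2: "d\<^sub>2 = m * k\<^sub>2" by (rule dvdE)
  have "m * d\<^sub>3 = m * (- 2 * ((- d\<^sub>3 - k) + k\<^sub>2))"
    using degree d\<^sub>1 d\<^sub>2 by (simp add: algebra_simps)
  then have "d\<^sub>3 = - 2 * ((- d\<^sub>3 - k) + k\<^sub>2)" using \<open>odd m\<close> by (subst (asm) mult_cancel_left) auto
  with d\<^sub>1 d\<^sub>2 show thesis by (rule that)
qed

lemma moment_const:
  assumes "odd m" and "m > 0"
  shows "[moment m (\<lambda>_. a) = 0] (mod m)"
proof -
  have "[moment m (\<lambda>_. a) + moment m (\<lambda>_. a) = 0 * (\<Sum>i=1..m. a)] (mod m)"
    by (rule moment_reflect[OF _ \<open>m > 0\<close>]) (simp add: periodic_fun_simple_def)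
  then show ?thesis
    using cong_double_iff[OF \<open>odd m\<close>, of "moment m (\<lambda>_. a)" 0] by simp
qed

section \<open>The module of integer-valued functions\<close>

definition int_scale :: "int \<Rightarrow> ('v \<Rightarrow> int) \<Rightarrow> 'v \<Rightarrow> int" (infixr \<open>*\<^sub>Z\<close> 75) where
  "a *\<^sub>Z f = (\<lambda>v. a * f v)"

lemma int_scale_apply [simp]: "(a *\<^sub>Z f) v = a * f v"
  by (simp add: int_scale_def)

interpretation int_fun: module int_scale
  by standard (simp_all add: fun_eq_iff algebra_simps)

lemma sum_fun_apply: "(\<Sum>i\<in>I. f i) v = (\<Sum>i\<in>I. f i v)"
  by (induction I rule: infinite_finite_induct) simp_all

definition point :: "'v \<Rightarrow> 'v \<Rightarrow> int" where
  "point v = (\<lambda>w. of_bool (w = v))"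

lemma sum_points_eq:
  assumes "finite S" and "\<And>v. v \<notin> S \<Longrightarrow> f v = 0"
  shows "(\<Sum>v\<in>S. f v *\<^sub>Z point v) = f"
proof
  fix w
  have "(\<Sum>v\<in>S. f v *\<^sub>Z point v) w = (\<Sum>v\<in>S. if v = w then f v else 0)"
    unfolding sum_fun_apply by (rule sum.cong) (auto simp: point_def)
  then show "(\<Sum>v\<in>S. f v *\<^sub>Z point v) w = f w"
    using assms by (simp add: sum.delta)
qed

section \<open>Pullbacks of divisors of a given degree\<close>

lemma divisor_degree_add: "divisor_degree G (f + g) = divisor_degree G f + divisor_degree G g"
  by (simp add: divisor_degree_def sum.distrib)

lemma divisor_degree_scale: "divisor_degree G (a *\<^sub>Z f) = a * divisor_degree G f"
  by (simp add: divisor_degree_def sum_distrib_left)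

definition pullbacks_deg ::
  "('g, 'm) monoid_scheme \<Rightarrow> ('v, 'e) multigraph \<Rightarrow> ('g \<Rightarrow> 'v \<Rightarrow> 'v) \<Rightarrow> ('g \<Rightarrow> 'e \<Rightarrow> 'e)
     \<Rightarrow> int \<Rightarrow> ('v \<Rightarrow> int) set"
where
  "pullbacks_deg \<Gamma> G \<phi> \<psi> d =
     {pullback \<Gamma> G \<phi> \<delta> | \<delta>.
        \<delta> \<in> divisors (quotient_graph \<Gamma> G \<phi> \<psi>) \<and>
        divisor_degree (quotient_graph \<Gamma> G \<phi> \<psi>) \<delta> = d}"

lemma pullbacks_deg0_eq: "pullbacks_deg0 \<Gamma> G \<phi> \<psi> = pullbacks_deg \<Gamma> G \<phi> \<psi> 0"
  by (simp add: pullbacks_deg0_def pullbacks_deg_def)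

lemma pullbacks_degE:
  assumes "f \<in> pullbacks_deg \<Gamma> G \<phi> \<psi> d"
  obtains \<delta> where "f = pullback \<Gamma> G \<phi> \<delta>" and "\<delta> \<in> divisors (quotient_graph \<Gamma> G \<phi> \<psi>)"
    and "divisor_degree (quotient_graph \<Gamma> G \<phi> \<psi>) \<delta> = d"
  using assms unfolding pullbacks_deg_def by blast

lemma pullbacks_deg_add:
  assumes "f \<in> pullbacks_deg \<Gamma> G \<phi> \<psi> d" and "f' \<in> pullbacks_deg \<Gamma> G \<phi> \<psi> d'"
  shows "f + f' \<in> pullbacks_deg \<Gamma> G \<phi> \<psi> (d + d')"
proof -
  obtain \<delta> where \<delta>: "f = pullback \<Gamma> G \<phi> \<delta>" "\<delta> \<in> divisors (quotient_graph \<Gamma> G \<phi> \<psi>)"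
    "divisor_degree (quotient_graph \<Gamma> G \<phi> \<psi>) \<delta> = d" by (rule pullbacks_degE[OF assms(1)])
  obtain \<delta>' where \<delta>': "f' = pullback \<Gamma> G \<phi> \<delta>'" "\<delta>' \<in> divisors (quotient_graph \<Gamma> G \<phi> \<psi>)"
    "divisor_degree (quotient_graph \<Gamma> G \<phi> \<psi>) \<delta>' = d'" by (rule pullbacks_degE[OF assms(2)])
  have "f + f' = pullback \<Gamma> G \<phi> (\<delta> + \<delta>')"
    by (simp add: \<delta>(1) \<delta>'(1) pullback_def fun_eq_iff distrib_left)
  moreover have "\<delta> + \<delta>' \<in> divisors (quotient_graph \<Gamma> G \<phi> \<psi>)"
    using \<delta>(2) \<delta>'(2) by (simp add: divisors_def)
  ultimately show ?thesis
    using \<delta>(3) \<delta>'(3) divisor_degree_add unfolding pullbacks_deg_def by blast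
qed

lemma pullbacks_deg_scale:
  assumes "f \<in> pullbacks_deg \<Gamma> G \<phi> \<psi> d"
  shows "a *\<^sub>Z f \<in> pullbacks_deg \<Gamma> G \<phi> \<psi> (a * d)"
proof -
  obtain \<delta> where \<delta>: "f = pullback \<Gamma> G \<phi> \<delta>" "\<delta> \<in> divisors (quotient_graph \<Gamma> G \<phi> \<psi>)"
    "divisor_degree (quotient_graph \<Gamma> G \<phi> \<psi>) \<delta> = d" by (rule pullbacks_degE[OF assms])
  have "a *\<^sub>Z f = pullback \<Gamma> G \<phi> (a *\<^sub>Z \<delta>)"
    by (simp add: \<delta>(1) pullback_def fun_eq_iff)
  moreover have "a *\<^sub>Z \<delta> \<in> divisors (quotient_graph \<Gamma> G \<phi> \<psi>)"
    using \<delta>(2) by (simp add: divisors_def)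
  ultimately show ?thesis
    using \<delta>(3) divisor_degree_scale unfolding pullbacks_deg_def by blast
qed

lemma pullbacks_deg_zero: "0 \<in> pullbacks_deg \<Gamma> G \<phi> \<psi> 0"
proof -
  have "0 = pullback \<Gamma> G \<phi> 0" by (simp add: pullback_def fun_eq_iff)
  moreover have "0 \<in> divisors (quotient_graph \<Gamma> G \<phi> \<psi>)" by (simp add: divisors_def)
  moreover have "divisor_degree (quotient_graph \<Gamma> G \<phi> \<psi>) 0 = 0" by (simp add: divisor_degree_def)
  ultimately show ?thesis unfolding pullbacks_deg_def by blast
qed

lemma pullbacks_deg_sum:
  assumes "finite I" and "\<And>i. i \<in> I \<Longrightarrow> f i \<in> pullbacks_deg \<Gamma> G \<phi> \<psi> (d i)"
  shows "(\<Sum>i\<in>I. f i) \<in> pullbacks_deg \<Gamma> G \<phi> \<psi> (\<Sum>i\<in>I. d i)"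
  using assms by (induction I rule: finite_induct) (simp_all add: pullbacks_deg_zero pullbacks_deg_add)

section \<open>Pullbacks along finite group actions\<close>

context group_action
begin

sublocale group G
  using group_hom by (rule group_hom.axioms)

lemma one_action: "x \<in> E \<Longrightarrow> \<phi> \<one> x = x"
  using id_eq_one by (metis restrict_apply')

lemma mem_orbit_iff:
  assumes "x \<in> E"
  shows "y \<in> orbit G \<phi> x \<longleftrightarrow> y \<in> E \<and> orbit G \<phi> y = orbit G \<phi> x"
proof (intro iffI conjI)
  assume y: "y \<in> orbit G \<phi> x"
  then show "y \<in> E" using element_image assms by (auto simp: orbit_def)
  then have "y \<in> orbit G \<phi> y \<inter> orbit G \<phi> x" using y orbit_refl by simp
  then show "orbit G \<phi> y = orbit G \<phi> x"
    using disjoint_union[of "orbit G \<phi> y" "orbit G \<phi> x"] \<open>y \<in> E\<close> assms by (auto simp: orbits_def)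
qed (use orbit_refl in blast)

lemma card_transporter:
  assumes x: "x \<in> E" and "y \<in> orbit G \<phi> x"
  shows "card {g \<in> carrier G. \<phi> g x = y} = card (stabilizer G \<phi> y)"
proof -
  obtain h where h: "h \<in> carrier G" "y = \<phi> h x" using assms(2) by (auto simp: orbit_def)
  have "bij_betw (\<lambda>k. k \<otimes> h) (stabilizer G \<phi> y) {g \<in> carrier G. \<phi> g x = y}"
  proof (rule bij_betw_byWitness[where f'="\<lambda>g. g \<otimes> inv h"])
    show "(\<lambda>k. k \<otimes> h) ` stabilizer G \<phi> y \<subseteq> {g \<in> carrier G. \<phi> g x = y}"
      using h x by (auto simp: stabilizer_def composition_rule)
    have "y \<in> E" and "\<phi> (inv h) y = x"
      using h x element_image orbit_sym_aux by blast+
    then show "(\<lambda>g. g \<otimes> inv h) ` {g \<in> carrier G. \<phi> g x = y} \<subseteq> stabilizer G \<phi> y"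
      using h(1) by (auto simp: stabilizer_def composition_rule)
  qed (use h(1) in \<open>auto simp: stabilizer_def m_assoc\<close>)
  then show ?thesis by (rule bij_betw_same_card[symmetric])
qed

end

locale finite_vertex_action = group_action \<Gamma> "verts G" \<phi>
  for \<Gamma> :: "('g, 'm) monoid_scheme" (structure) and G :: "('v, 'e) multigraph" and \<phi> +
  assumes finite_verts: "finite (verts G)" and finite_carrier: "finite (carrier \<Gamma>)"
begin

lemma translates_pullback:
  assumes "v \<in> verts G"
  shows "(\<Sum>g\<in>carrier \<Gamma>. point (\<phi> g v)) \<in> pullbacks_deg \<Gamma> G \<phi> \<psi> 1"
proof -
  let ?H = "quotient_graph \<Gamma> G \<phi> \<psi>" and ?B = "orbit \<Gamma> \<phi> v"
  have B: "?B \<in> verts ?H" using assms by (auto simp: quotient_graph_def orbits_def)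
  have "(\<Sum>g\<in>carrier \<Gamma>. point (\<phi> g v)) w = pullback \<Gamma> G \<phi> (point ?B) w" for w
  proof -
    have "(\<Sum>g\<in>carrier \<Gamma>. point (\<phi> g v)) w = (\<Sum>g\<in>carrier \<Gamma>. of_bool (\<phi> g v = w))"
      unfolding sum_fun_apply by (rule sum.cong) (auto simp: point_def)
    also have "\<dots> = int (card {g \<in> carrier \<Gamma>. \<phi> g v = w})"
      using finite_carrier by (simp add: Int_def)
    also have "\<dots> = (if w \<in> ?B then int (card (stabilizer \<Gamma> \<phi> w)) else 0)"
      using card_transporter[OF assms, of w] by (auto simp: orbit_def card_eq_0_iff)
    finally show ?thesis
      using mem_orbit_iff[OF assms, of w] by (simp add: pullback_def point_def)
  qed
  moreover have "point ?B \<in> divisors ?H" using B by (auto simp: divisors_def point_def)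
  moreover have "divisor_degree ?H (point ?B) = 1"
    using B finite_verts by (simp add: divisor_degree_def point_def quotient_graph_def orbits_def)
  ultimately show ?thesis unfolding pullbacks_deg_def by blast
qed

lemma pullback_invariant:
  assumes "f \<in> pullbacks_deg \<Gamma> G \<phi> \<psi> d" and g: "g \<in> carrier \<Gamma>" and v: "v \<in> verts G"
  shows "f (\<phi> g v) = f v"
proof -
  have gv: "\<phi> g v \<in> verts G" using element_image[OF g v] by simp
  have "\<phi> g v \<in> orbit \<Gamma> \<phi> v" using g by (auto simp: orbit_def)
  then have orbit: "orbit \<Gamma> \<phi> (\<phi> g v) = orbit \<Gamma> \<phi> v"
    using mem_orbit_iff[OF v] by blast
  have "finite (orbit \<Gamma> \<phi> v)" using finite_carrier by (simp add: orbit_def)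
  then have "card (orbit \<Gamma> \<phi> v) \<noteq> 0" using orbit_refl[OF v] by auto
  then have "card (stabilizer \<Gamma> \<phi> (\<phi> g v)) = card (stabilizer \<Gamma> \<phi> v)"
    using orbit_stabilizer_theorem[OF gv] orbit_stabilizer_theorem[OF v] orbit by (metis mult_cancel1)
  moreover obtain \<delta> where "f = pullback \<Gamma> G \<phi> \<delta>" by (rule pullbacks_degE[OF assms(1)])
  ultimately show ?thesis using orbit v gv by (simp add: pullback_def)
qed

lemma divisor_degree_pullback:
  assumes "f \<in> pullbacks_deg \<Gamma> G \<phi> \<psi> d"
  shows "divisor_degree G f = int (order \<Gamma>) * d"
proof -
  let ?O = "orbits \<Gamma> (verts G) \<phi>"
  obtain \<delta> where \<delta>: "f = pullback \<Gamma> G \<phi> \<delta>" "(\<Sum>B\<in>?O. \<delta> B) = d"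
    using pullbacks_degE[OF assms] by (auto simp: divisor_degree_def quotient_graph_def)
  have "(\<Sum>v\<in>B. f v) = int (order \<Gamma>) * \<delta> B" if B: "B \<in> ?O" for B
  proof -
    have "v \<in> verts G \<and> orbit \<Gamma> \<phi> v = B" if "v \<in> B" for v
      using B that by (auto simp: orbits_def mem_orbit_iff)
    then have "(\<Sum>v\<in>B. f v) = (\<Sum>v\<in>B. int (card (stabilizer \<Gamma> \<phi> v)) * \<delta> B)"
      by (intro sum.cong) (auto simp: \<delta>(1) pullback_def)
    also have "\<dots> = int (\<Sum>v\<in>B. card (stabilizer \<Gamma> \<phi> v)) * \<delta> B"
      by (simp add: sum_distrib_right)
    finally show ?thesis using card_stablizer_sum[OF finite_carrier B] by simp
  qed
  then have "(\<Sum>B\<in>?O. \<Sum>v\<in>B. f v) = int (order \<Gamma>) * d"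
    by (simp add: \<delta>(2)[symmetric] sum_distrib_left)
  then show ?thesis using disjoint_sum[OF finite_verts, of f] by (simp add: divisor_degree_def)
qed

lemma subgroup_action:
  assumes "subgroup H \<Gamma>"
  shows "finite_vertex_action (\<Gamma>\<lparr>carrier := H\<rparr>) G \<phi>"
proof (intro finite_vertex_action.intro finite_vertex_action_axioms.intro)
  show "group_action (\<Gamma>\<lparr>carrier := H\<rparr>) (verts G) \<phi>" by (rule induced_action[OF assms])
  show "finite (carrier (\<Gamma>\<lparr>carrier := H\<rparr>))"
    using finite_subset[OF subgroup.subset[OF assms] finite_carrier] by simp
qed (rule finite_verts)

lemma translates_pullback_subgroup:
  assumes H: "subgroup H \<Gamma>" and v: "v \<in> verts G"
  shows "(\<Sum>g\<in>carrier \<Gamma>. point (\<phi> g v))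
    \<in> pullbacks_deg (\<Gamma>\<lparr>carrier := H\<rparr>) G \<phi> \<psi> (int (card (rcosets H)))"
proof -
  interpret H: finite_vertex_action "\<Gamma>\<lparr>carrier := H\<rparr>" G \<phi> by (rule subgroup_action[OF H])
  have H_carrier: "H \<subseteq> carrier \<Gamma>" by (rule subgroup.subset[OF H])
  have coset: "(\<Sum>g\<in>C. point (\<phi> g v)) \<in> pullbacks_deg (\<Gamma>\<lparr>carrier := H\<rparr>) G \<phi> \<psi> 1"
    if "C \<in> rcosets H" for C
  proof -
    obtain r where r: "r \<in> carrier \<Gamma>" "C = (\<lambda>h. h \<otimes> r) ` H"
      using \<open>C \<in> rcosets H\<close> by (auto simp: RCOSETS_def r_coset_def)
    have "(\<Sum>g\<in>C. point (\<phi> g v)) = (\<Sum>h\<in>H. point (\<phi> (h \<otimes> r) v))"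
      using inj_on_g[OF H_carrier r(1)] by (simp add: r(2) sum.reindex)
    also have "\<dots> = (\<Sum>h\<in>H. point (\<phi> h (\<phi> r v)))"
      using H_carrier r(1) v by (intro sum.cong) (auto simp: composition_rule)
    also have "\<dots> \<in> pullbacks_deg (\<Gamma>\<lparr>carrier := H\<rparr>) G \<phi> \<psi> 1"
      using H.translates_pullback[OF element_image[OF r(1) v refl]] by simp
    finally show ?thesis .
  qed
  have finite_rcosets: "finite (rcosets H)"
    using finite_carrier by (simp add: RCOSETS_def)
  have "(\<Sum>C\<in>rcosets H. \<Sum>g\<in>C. point (\<phi> g v))
      \<in> pullbacks_deg (\<Gamma>\<lparr>carrier := H\<rparr>) G \<phi> \<psi> (\<Sum>C\<in>rcosets H. 1)"
    by (rule pullbacks_deg_sum[OF finite_rcosets coset])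
  moreover have "(\<Sum>C\<in>rcosets H. \<Sum>g\<in>C. point (\<phi> g v)) = (\<Sum>g\<in>\<Union>(rcosets H). point (\<phi> g v))"
  proof (rule sum.Union_disjoint[symmetric, unfolded comp_def])
    show "\<forall>C\<in>rcosets H. finite C"
      using rcosets_finite[OF _ H_carrier] H.finite_carrier by simp
    show "\<forall>B\<in>rcosets H. \<forall>C\<in>rcosets H. B \<noteq> C \<longrightarrow> B \<inter> C = {}"
      using rcos_disjoint[OF H] unfolding pairwise_def disjnt_def by blast
  qed
  ultimately show ?thesis unfolding rcosets_part_G[OF H] by simp
qed

end

section \<open>Groups generated by two involutions\<close>

lemma (in group) carrier_subgroup_generated_involution:
  assumes "a \<in> carrier G" and "a \<otimes> a = \<one>"
  shows "carrier (subgroup_generated G {a}) = {\<one>, a}"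
proof
  have "inv a = a" using assms by (simp add: inv_equality)
  then have "subgroup {\<one>, a} G" using assms by (intro subgroupI) auto
  then show "carrier (subgroup_generated G {a}) \<subseteq> {\<one>, a}"
    by (intro subgroup_generated_minimal) auto
  show "{\<one>, a} \<subseteq> carrier (subgroup_generated G {a})"
    using assms(1) by (auto simp: carrier_subgroup_generated intro: generate.intros)
qed

context group
begin

context
  fixes a b
  assumes a: "a \<in> carrier G" "a \<otimes> a = \<one>" and b: "b \<in> carrier G" "b \<otimes> b = \<one>"
begin

lemma inv_mult_involutions: "inv (a \<otimes> b) = b \<otimes> a"
  using a b by (simp add: inv_mult_group inv_equality)

lemma involution_mult_rotation:
  fixes k :: int
  shows "a \<otimes> (a \<otimes> b) [^] k = (a \<otimes> b) [^] (- k) \<otimes> a"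
proof -
  have inv_a: "inv a = a" using a by (simp add: inv_equality)
  have conj: "(\<lambda>x. a \<otimes> x \<otimes> inv a) \<in> hom G G"
    using a(1) by (intro homI) (auto simp: m_assoc inv_solve_left)
  have "a \<otimes> (a \<otimes> b) [^] k \<otimes> a = (a \<otimes> (a \<otimes> b) \<otimes> a) [^] k"
    using hom_int_pow[OF conj, of "a \<otimes> b" k] a(1) b(1) by (simp add: inv_a)
  also have "a \<otimes> (a \<otimes> b) \<otimes> a = inv (a \<otimes> b)"
    using a b by (simp add: inv_mult_involutions m_assoc[symmetric])
  also have "inv (a \<otimes> b) [^] k = (a \<otimes> b) [^] (- k)"
    using a(1) b(1) by (simp add: int_pow_inv int_pow_neg)
  finally have "a \<otimes> (a \<otimes> b) [^] k \<otimes> a \<otimes> a = (a \<otimes> b) [^] (- k) \<otimes> a" by simp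
  then show ?thesis using a b(1) by (simp add: m_assoc)
qed

lemma involution_notin_rotations:
  assumes "a \<noteq> \<one>" and "b \<noteq> \<one>"
  shows "a \<notin> range (\<lambda>k::int. (a \<otimes> b) [^] k)"
proof
  have rotation: "a \<otimes> b \<in> carrier G" using a(1) b(1) by simp
  assume "a \<in> range (\<lambda>k::int. (a \<otimes> b) [^] k)"
  then obtain k :: int where k: "a = (a \<otimes> b) [^] k" by blast
  have "a \<otimes> (a \<otimes> b) = (a \<otimes> b) \<otimes> a"
    using rotation int_pow_mult[of "a \<otimes> b" k 1] int_pow_mult[of "a \<otimes> b" 1 k]
    by (simp add: k[symmetric] add.commute)
  also have "a \<otimes> (a \<otimes> b) = inv (a \<otimes> b) \<otimes> a"
    using involution_mult_rotation[of 1] rotation by (simp add: int_pow_neg)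
  finally have "inv (a \<otimes> b) = a \<otimes> b" using a(1) rotation by simp
  then have "(a \<otimes> b) \<otimes> (a \<otimes> b) = \<one>" using rotation by (metis r_inv)
  then have "range (\<lambda>k::int. (a \<otimes> b) [^] k) = {\<one>, a \<otimes> b}"
    using carrier_subgroup_generated_involution[OF rotation]
      carrier_subgroup_generated_by_singleton[OF rotation] by simp
  then have "a = a \<otimes> b" using k \<open>a \<noteq> \<one>\<close> by blast
  then show False using a(1) b(1) \<open>b \<noteq> \<one>\<close> by simp
qed

lemma subgroup_rotations_reflections:
  defines "R \<equiv> range (\<lambda>k::int. (a \<otimes> b) [^] k)"
  shows "subgroup (R \<union> (R #> a)) G"
proof -
  let ?\<rho> = "\<lambda>k::int. (a \<otimes> b) [^] k"
  have \<rho>: "?\<rho> k \<in> carrier G" for k using a(1) b(1) by simp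
  have mem_iff: "x \<in> R \<union> (R #> a) \<longleftrightarrow> (\<exists>k. x = ?\<rho> k \<or> x = ?\<rho> k \<otimes> a)" for x
    by (auto simp: R_def r_coset_def)
  have rot_rot: "?\<rho> k \<otimes> ?\<rho> l = ?\<rho> (k + l)" for k l
    using a(1) b(1) by (simp add: int_pow_mult)
  have rot_refl: "?\<rho> k \<otimes> (?\<rho> l \<otimes> a) = ?\<rho> (k + l) \<otimes> a" for k l
    using \<rho> a(1) by (simp add: m_assoc[symmetric] rot_rot)
  have refl_rot: "?\<rho> k \<otimes> a \<otimes> ?\<rho> l = ?\<rho> (k - l) \<otimes> a" for k l
    using \<rho> a(1) rot_refl[of k "- l"] by (simp add: m_assoc involution_mult_rotation)
  have refl_refl: "?\<rho> k \<otimes> a \<otimes> (?\<rho> l \<otimes> a) = ?\<rho> (k - l)" for k l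
    using \<rho> a by (simp add: m_assoc[symmetric] refl_rot) (simp add: m_assoc)
  show ?thesis
  proof (rule subgroupI)
    show "R \<union> (R #> a) \<subseteq> carrier G" unfolding subset_iff mem_iff using \<rho> a(1) by auto
    show "R \<union> (R #> a) \<noteq> {}" by (simp add: R_def)
    show "inv x \<in> R \<union> (R #> a)" if "x \<in> R \<union> (R #> a)" for x
    proof -
      have "inv (?\<rho> k) = ?\<rho> (- k)" for k using a(1) b(1) by (simp add: int_pow_neg)
      moreover have "inv (?\<rho> k \<otimes> a) = ?\<rho> k \<otimes> a" for k
        using refl_refl[of k k] \<rho> a(1) by (simp add: inv_equality)
      ultimately show ?thesis using that unfolding mem_iff by metis
    qed
    show "x \<otimes> y \<in> R \<union> (R #> a)" if "x \<in> R \<union> (R #> a)" "y \<in> R \<union> (R #> a)" for x y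
      using that rot_rot rot_refl refl_rot refl_refl unfolding mem_iff by metis
  qed
qed

lemma card_rcosets_rotations:
  defines "R \<equiv> range (\<lambda>k::int. (a \<otimes> b) [^] k)"
  assumes "a \<noteq> \<one>" and "b \<noteq> \<one>" and "generate G {a, b} = carrier G"
  shows "card (rcosets R) = 2"
proof -
  have subgroup_R: "subgroup R G"
    unfolding R_def using a(1) b(1) by (intro subgroup_of_powers) simp
  have "inv (a \<otimes> b) \<in> R"
    unfolding R_def using a(1) b(1) by (intro image_eqI[of _ _ "- 1"]) (simp_all add: int_pow_neg)
  moreover have "b = inv (a \<otimes> b) \<otimes> a"
    using a b by (simp add: inv_mult_involutions m_assoc)
  ultimately have "b \<in> R #> a" unfolding r_coset_def by blast
  moreover have a_coset: "a \<in> R #> a" by (rule rcos_self[OF a(1) subgroup_R])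
  ultimately have "generate G {a, b} \<subseteq> R \<union> (R #> a)"
    by (intro generate_subgroup_incl subgroup_rotations_reflections[folded R_def]) auto
  then have carrier: "carrier G \<subseteq> R \<union> (R #> a)" using assms(4) by simp
  have "rcosets R = {R, R #> a}"
  proof
    show "rcosets R \<subseteq> {R, R #> a}"
      using carrier coset_join2[OF _ subgroup_R] repr_independence[OF _ a(1) subgroup_R]
      by (auto simp: RCOSETS_def)
    show "{R, R #> a} \<subseteq> rcosets R"
      using subgroup.subgroup_in_rcosets[OF subgroup_R is_group]
        rcosetsI[OF subgroup.subset[OF subgroup_R] a(1)] by simp
  qed
  moreover have "R \<noteq> R #> a"
    using a_coset involution_notin_rotations[OF assms(2,3)] by (auto simp: R_def)
  ultimately show ?thesis by simp
qed

end

end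

lemma (in group) card_rcosets_subgroup_generated:
  "card (rcosets carrier (subgroup_generated G S)) * order (subgroup_generated G S) = order G"
  using lagrange[OF subgroup_subgroup_generated] by (simp add: order_def)

lemma (in group)
  assumes "a \<in> carrier G" "a \<otimes> a = \<one>" "a \<noteq> \<one>" and "order G = 2 * n"
  shows order_subgroup_generated_involution: "order (subgroup_generated G {a}) = 2"
    and card_rcosets_involution: "card (rcosets carrier (subgroup_generated G {a})) = n"
proof -
  show "order (subgroup_generated G {a}) = 2"
    using assms(1-3) by (simp add: order_def carrier_subgroup_generated_involution)
  then show "card (rcosets carrier (subgroup_generated G {a})) = n"
    using card_rcosets_subgroup_generated[of "{a}"] assms(4) by simp
qed

lemma
  assumes "dihedral_group D n \<sigma>\<^sub>1 \<sigma>\<^sub>2"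
  shows order_dihedral_rotations: "order (subgroup_generated D {\<sigma>\<^sub>1 \<otimes>\<^bsub>D\<^esub> \<sigma>\<^sub>2}) = n"
    and card_rcosets_dihedral_rotations:
      "card (rcosets\<^bsub>D\<^esub> carrier (subgroup_generated D {\<sigma>\<^sub>1 \<otimes>\<^bsub>D\<^esub> \<sigma>\<^sub>2})) = 2"
proof -
  interpret group D using assms by (simp add: dihedral_group_def)
  show "card (rcosets\<^bsub>D\<^esub> carrier (subgroup_generated D {\<sigma>\<^sub>1 \<otimes>\<^bsub>D\<^esub> \<sigma>\<^sub>2})) = 2"
    using card_rcosets_rotations[of \<sigma>\<^sub>1 \<sigma>\<^sub>2] assms
    by (simp add: dihedral_group_def carrier_subgroup_generated_by_singleton)
  then show "order (subgroup_generated D {\<sigma>\<^sub>1 \<otimes>\<^bsub>D\<^esub> \<sigma>\<^sub>2}) = n"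
    using card_rcosets_subgroup_generated[of "{\<sigma>\<^sub>1 \<otimes>\<^bsub>D\<^esub> \<sigma>\<^sub>2}"] assms
    by (simp add: dihedral_group_def)
qed

section \<open>Dihedral actions and strands\<close>

locale dihedral_vertex_action = finite_vertex_action D G \<phi>
  for D :: "('g, 'm) monoid_scheme" (structure) and G :: "('v, 'e) multigraph" and \<phi> +
  fixes n :: nat and \<sigma>\<^sub>1 \<sigma>\<^sub>2 :: 'g and \<psi> :: "'g \<Rightarrow> 'e \<Rightarrow> 'e"
  assumes dihedral: "dihedral_group D n \<sigma>\<^sub>1 \<sigma>\<^sub>2" and odd_n: "odd n"
begin

abbreviation rotation where "rotation \<equiv> \<sigma>\<^sub>1 \<otimes> \<sigma>\<^sub>2"

abbreviation pullbacks\<^sub>1 where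
  "pullbacks\<^sub>1 \<equiv> pullbacks_deg (subgroup_generated D {\<sigma>\<^sub>1}) G \<phi> \<psi>"
abbreviation pullbacks\<^sub>2 where
  "pullbacks\<^sub>2 \<equiv> pullbacks_deg (subgroup_generated D {\<sigma>\<^sub>2}) G \<phi> \<psi>"
abbreviation pullbacks\<^sub>3 where
  "pullbacks\<^sub>3 \<equiv> pullbacks_deg (subgroup_generated D {rotation}) G \<phi> \<psi>"

lemma n_pos: "n > 0"
  using odd_n by (rule odd_pos)

lemma order_D: "order D = 2 * n"
  using dihedral by (simp add: dihedral_group_def)

lemma reflections:
  "\<sigma>\<^sub>1 \<in> carrier D" "\<sigma>\<^sub>1 \<otimes> \<sigma>\<^sub>1 = \<one>" "\<sigma>\<^sub>1 \<noteq> \<one>" "\<sigma>\<^sub>2 \<in> carrier D" "\<sigma>\<^sub>2 \<otimes> \<sigma>\<^sub>2 = \<one>" "\<sigma>\<^sub>2 \<noteq> \<one>"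
  using dihedral by (auto simp: dihedral_group_def)

lemma generated_action: "finite_vertex_action (subgroup_generated D S) G \<phi>"
  unfolding subgroup_generated_def by (rule subgroup_action) (simp add: generate_is_subgroup)

lemma generator_invariant:
  assumes "\<sigma> \<in> carrier D" and "f \<in> pullbacks_deg (subgroup_generated D {\<sigma>}) G \<phi> \<psi> d" and "v \<in> verts G"
  shows "f (\<phi> \<sigma> v) = f v"
  using assms
  by (intro finite_vertex_action.pullback_invariant[OF generated_action])
    (auto simp: carrier_subgroup_generated intro: generate.incl)

lemma reflection_pullback:
  assumes "\<sigma> \<in> carrier D" "\<sigma> \<otimes> \<sigma> = \<one>" "\<sigma> \<noteq> \<one>" and "v \<in> verts G"
  shows "point v + point (\<phi> \<sigma> v) \<in> pullbacks_deg (subgroup_generated D {\<sigma>}) G \<phi> \<psi> 1"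
  using finite_vertex_action.translates_pullback[OF generated_action \<open>v \<in> verts G\<close>, of "{\<sigma>}"] assms
  by (simp add: carrier_subgroup_generated_involution one_action)

lemma all_translates_pullback:
  assumes "v \<in> verts G"
  defines "u \<equiv> \<Sum>g\<in>carrier D. point (\<phi> g v)"
  shows "u \<in> pullbacks\<^sub>1 (int n)" and "u \<in> pullbacks\<^sub>2 (int n)" and "u \<in> pullbacks\<^sub>3 2"
proof -
  have u: "u \<in> pullbacks_deg (subgroup_generated D S) G \<phi> \<psi>
      (int (card (rcosets carrier (subgroup_generated D S))))" for S
    using translates_pullback_subgroup[OF subgroup_subgroup_generated[of S] \<open>v \<in> verts G\<close>]
    unfolding u_def by (simp add: subgroup_generated_def)
  note index = card_rcosets_involution[OF _ _ _ order_D]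
  show "u \<in> pullbacks\<^sub>1 (int n)" using u[of "{\<sigma>\<^sub>1}"] index[OF reflections(1-3)] by simp
  show "u \<in> pullbacks\<^sub>2 (int n)" using u[of "{\<sigma>\<^sub>2}"] index[OF reflections(4-6)] by simp
  show "u \<in> pullbacks\<^sub>3 2" using u[of "{rotation}"] card_rcosets_dihedral_rotations[OF dihedral] by simp
qed

text \<open>An orbit of size \<open>n\<close> is treated as a strand paired with itself, \<open>p = q = z\<^sup>j\<close>.\<close>

definition strand_pair :: "(int \<Rightarrow> 'v) \<Rightarrow> (int \<Rightarrow> 'v) \<Rightarrow> bool" where
  "strand_pair p q \<longleftrightarrow> periodic_fun_simple p (int n) \<and>
     (\<forall>i. p i \<in> verts G \<and> \<phi> \<sigma>\<^sub>1 (p i) = q (1 - i) \<and> \<phi> \<sigma>\<^sub>2 (p i) = q (2 - i))"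

lemma strand_pairI:
  assumes p: "periodic_fun_simple p (int n)" and q: "periodic_fun_simple q (int n)"
    and range: "p ` {1..int n} \<subseteq> verts G"
    and \<sigma>\<^sub>1: "\<And>i. \<phi> \<sigma>\<^sub>1 (p i) = q (int n + 1 - i)" and \<sigma>\<^sub>2: "\<And>i. \<phi> \<sigma>\<^sub>2 (p i) = q (int n + 2 - i)"
  shows "strand_pair p q"
  unfolding strand_pair_def
proof (intro conjI allI)
  fix i
  show "p i \<in> verts G"
    using subsetD[OF range imageI[OF residue_in_range]] periodic_fun_residue[OF p] n_pos by simp
  show "\<phi> \<sigma>\<^sub>1 (p i) = q (1 - i)" "\<phi> \<sigma>\<^sub>2 (p i) = q (2 - i)"
    unfolding \<sigma>\<^sub>1 \<sigma>\<^sub>2 by (rule periodic_fun_cong[OF q], simp add: cong_iff_dvd_diff)+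
qed (rule p)

lemma strand_pair_reflect:
  assumes "strand_pair p q"
  shows "p i \<in> verts G" "\<phi> \<sigma>\<^sub>1 (p i) = q (1 - i)" "\<phi> \<sigma>\<^sub>2 (p i) = q (2 - i)"
  using assms by (simp_all add: strand_pair_def)

lemma strand_pair_sym:
  assumes "strand_pair p q"
  shows "strand_pair q p"
proof -
  note p = strand_pair_reflect[OF assms]
  have involutive: "\<phi> \<sigma> (\<phi> \<sigma> v) = v" if "\<sigma> \<in> carrier D" "\<sigma> \<otimes> \<sigma> = \<one>" "v \<in> verts G" for \<sigma> v
    using composition_rule[of v \<sigma> \<sigma>] one_action that by simp
  have q: "q i = \<phi> \<sigma>\<^sub>1 (p (1 - i))" "q i = \<phi> \<sigma>\<^sub>2 (p (2 - i))" for i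
    using p(2)[of "1 - i"] p(3)[of "2 - i"] by simp_all
  show ?thesis unfolding strand_pair_def
  proof (intro conjI allI)
    interpret p: periodic_fun_simple p "int n" using assms by (simp add: strand_pair_def)
    show "periodic_fun_simple q (int n)"
    proof
      show "q (i + int n) = q i" for i
        using p.minus_1[of "1 - i"] by (simp add: q(1) diff_diff_eq)
    qed
    fix i
    show "q i \<in> verts G" unfolding q(1) using element_image[OF reflections(1) p(1) refl] .
    show "\<phi> \<sigma>\<^sub>1 (q i) = p (1 - i)" unfolding q(1) using involutive reflections p(1) by simp
    show "\<phi> \<sigma>\<^sub>2 (q i) = p (2 - i)" unfolding q(2) using involutive reflections p(1) by simp
  qed
qed

lemma periodic_on_strand: "strand_pair p q \<Longrightarrow> periodic_fun_simple (\<lambda>i. f (p i)) (int n)"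
  by (simp add: strand_pair_def periodic_fun_simple_def)

lemma rotation_strand:
  assumes "strand_pair p q"
  shows "\<phi> rotation (p i) = p (i - 1)"
  using strand_pair_reflect[OF assms] strand_pair_reflect[OF strand_pair_sym[OF assms]] reflections
  by (simp add: composition_rule)

lemma rotation_pow_strand:
  fixes k :: int
  assumes "strand_pair p q"
  shows "\<phi> (rotation [^] k) (p i) = p (i - k)"
proof (induction k arbitrary: i rule: int_induct[where k=0])
  have rotation: "rotation \<in> carrier D" using reflections by simp
  note p_verts = strand_pair_reflect(1)[OF assms]
  {
    case base
    show ?case using one_action p_verts by simp
  next
    case (step1 k)
    have "\<phi> (rotation [^] (k + 1)) (p i) = \<phi> (rotation [^] k) (\<phi> rotation (p i))"
      using composition_rule p_verts rotation by (simp add: int_pow_mult)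
    then show ?case by (simp add: rotation_strand[OF assms] step1.IH algebra_simps)
  next
    case (step2 k)
    have "rotation [^] (k - 1) = rotation [^] k \<otimes> inv rotation"
      using int_pow_diff[OF rotation, of k 1] rotation by simp
    then have "\<phi> (rotation [^] (k - 1)) (p i) = \<phi> (rotation [^] k) (\<phi> (inv rotation) (p i))"
      using composition_rule p_verts rotation by simp
    also have "\<phi> (inv rotation) (p i) = p (i + 1)"
      using orbit_sym_aux[OF rotation p_verts, of "i + 1"] rotation_strand[OF assms, of "i + 1"] by simp
    finally show ?case by (simp add: step2.IH algebra_simps)
  }
qed

lemma
  assumes pq: "strand_pair p q"
  shows pullback\<^sub>1_on_strands: "f \<in> pullbacks\<^sub>1 d \<Longrightarrow> f (q (1 - i)) = f (p i)"
    and pullback\<^sub>2_on_strands: "f \<in> pullbacks\<^sub>2 d \<Longrightarrow> f (q (2 - i)) = f (p i)"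
    and pullback\<^sub>3_on_strands: "f \<in> pullbacks\<^sub>3 d \<Longrightarrow> f (p i) = f (p k)"
proof -
  note p = strand_pair_reflect[OF pq]
  show "f (q (1 - i)) = f (p i)" if "f \<in> pullbacks\<^sub>1 d"
    using generator_invariant[OF reflections(1) that p(1)] p(2) by simp
  show "f (q (2 - i)) = f (p i)" if "f \<in> pullbacks\<^sub>2 d"
    using generator_invariant[OF reflections(4) that p(1)] p(3) by simp
  show "f (p i) = f (p k)" if "f \<in> pullbacks\<^sub>3 d"
  proof -
    have "rotation [^] (i - k) \<in> carrier (subgroup_generated D {rotation})"
      using reflections by (simp add: carrier_subgroup_generated_by_singleton)
    from finite_vertex_action.pullback_invariant[OF generated_action that this p(1)[of i]]
    show ?thesis using rotation_pow_strand[OF pq, of "i - k" i] by simp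
  qed
qed

section \<open>Sums of pullbacks\<close>

definition pullback_sums :: "int \<Rightarrow> int \<Rightarrow> int \<Rightarrow> ('v \<Rightarrow> int) set" where
  "pullback_sums d\<^sub>1 d\<^sub>2 d\<^sub>3 =
     {f\<^sub>1 + f\<^sub>2 + f\<^sub>3 | f\<^sub>1 f\<^sub>2 f\<^sub>3. f\<^sub>1 \<in> pullbacks\<^sub>1 d\<^sub>1 \<and> f\<^sub>2 \<in> pullbacks\<^sub>2 d\<^sub>2 \<and> f\<^sub>3 \<in> pullbacks\<^sub>3 d\<^sub>3}"

lemma pullback_sum_eq: "pullback_sum D \<sigma>\<^sub>1 \<sigma>\<^sub>2 G \<phi> \<psi> = pullback_sums 0 0 0"
  by (simp add: pullback_sum_def pullback_sums_def pullbacks_deg0_eq plus_fun_def)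

lemma pullback_sumsI:
  assumes "f\<^sub>1 \<in> pullbacks\<^sub>1 d\<^sub>1" and "f\<^sub>2 \<in> pullbacks\<^sub>2 d\<^sub>2" and "f\<^sub>3 \<in> pullbacks\<^sub>3 d\<^sub>3"
  shows "f\<^sub>1 + f\<^sub>2 + f\<^sub>3 \<in> pullback_sums d\<^sub>1 d\<^sub>2 d\<^sub>3"
  using assms unfolding pullback_sums_def by blast

lemma pullback_sumsE:
  assumes "f \<in> pullback_sums d\<^sub>1 d\<^sub>2 d\<^sub>3"
  obtains f\<^sub>1 f\<^sub>2 f\<^sub>3 where "f = f\<^sub>1 + f\<^sub>2 + f\<^sub>3"
    and "f\<^sub>1 \<in> pullbacks\<^sub>1 d\<^sub>1" and "f\<^sub>2 \<in> pullbacks\<^sub>2 d\<^sub>2" and "f\<^sub>3 \<in> pullbacks\<^sub>3 d\<^sub>3"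
  using assms unfolding pullback_sums_def by blast

lemma pullbacks_subset_sums:
  "pullbacks\<^sub>1 d \<subseteq> pullback_sums d 0 0" "pullbacks\<^sub>2 d \<subseteq> pullback_sums 0 d 0"
  "pullbacks\<^sub>3 d \<subseteq> pullback_sums 0 0 d"
  using pullback_sumsI[OF _ pullbacks_deg_zero pullbacks_deg_zero]
    pullback_sumsI[OF pullbacks_deg_zero _ pullbacks_deg_zero]
    pullback_sumsI[OF pullbacks_deg_zero pullbacks_deg_zero]
  by auto

lemma pullback_sums_add:
  assumes "f \<in> pullback_sums d\<^sub>1 d\<^sub>2 d\<^sub>3" and "g \<in> pullback_sums e\<^sub>1 e\<^sub>2 e\<^sub>3"
  shows "f + g \<in> pullback_sums (d\<^sub>1 + e\<^sub>1) (d\<^sub>2 + e\<^sub>2) (d\<^sub>3 + e\<^sub>3)"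
proof -
  obtain f\<^sub>1 f\<^sub>2 f\<^sub>3 where f: "f = f\<^sub>1 + f\<^sub>2 + f\<^sub>3" "f\<^sub>1 \<in> pullbacks\<^sub>1 d\<^sub>1" "f\<^sub>2 \<in> pullbacks\<^sub>2 d\<^sub>2" "f\<^sub>3 \<in> pullbacks\<^sub>3 d\<^sub>3"
    by (rule pullback_sumsE[OF assms(1)])
  obtain g\<^sub>1 g\<^sub>2 g\<^sub>3 where g: "g = g\<^sub>1 + g\<^sub>2 + g\<^sub>3" "g\<^sub>1 \<in> pullbacks\<^sub>1 e\<^sub>1" "g\<^sub>2 \<in> pullbacks\<^sub>2 e\<^sub>2" "g\<^sub>3 \<in> pullbacks\<^sub>3 e\<^sub>3"
    by (rule pullback_sumsE[OF assms(2)])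
  have "(f\<^sub>1 + g\<^sub>1) + (f\<^sub>2 + g\<^sub>2) + (f\<^sub>3 + g\<^sub>3) \<in> pullback_sums (d\<^sub>1 + e\<^sub>1) (d\<^sub>2 + e\<^sub>2) (d\<^sub>3 + e\<^sub>3)"
    by (intro pullback_sumsI pullbacks_deg_add f g)
  then show ?thesis by (simp add: f(1) g(1) ac_simps)
qed

lemma pullback_sums_scale:
  assumes "f \<in> pullback_sums d\<^sub>1 d\<^sub>2 d\<^sub>3"
  shows "a *\<^sub>Z f \<in> pullback_sums (a * d\<^sub>1) (a * d\<^sub>2) (a * d\<^sub>3)"
proof -
  obtain f\<^sub>1 f\<^sub>2 f\<^sub>3 where f: "f = f\<^sub>1 + f\<^sub>2 + f\<^sub>3" "f\<^sub>1 \<in> pullbacks\<^sub>1 d\<^sub>1" "f\<^sub>2 \<in> pullbacks\<^sub>2 d\<^sub>2" "f\<^sub>3 \<in> pullbacks\<^sub>3 d\<^sub>3"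
    by (rule pullback_sumsE[OF assms])
  show ?thesis
    unfolding f(1) int_fun.scale_right_distrib by (intro pullback_sumsI pullbacks_deg_scale f)
qed

lemma divisor_degree_pullback_sums:
  assumes "f \<in> pullback_sums d\<^sub>1 d\<^sub>2 d\<^sub>3"
  shows "divisor_degree G f = 2 * d\<^sub>1 + 2 * d\<^sub>2 + int n * d\<^sub>3"
proof -
  note order = order_subgroup_generated_involution[OF reflections(1-3) order_D]
    order_subgroup_generated_involution[OF reflections(4-6) order_D] order_dihedral_rotations[OF dihedral]
  obtain f\<^sub>1 f\<^sub>2 f\<^sub>3 where "f = f\<^sub>1 + f\<^sub>2 + f\<^sub>3" "f\<^sub>1 \<in> pullbacks\<^sub>1 d\<^sub>1" "f\<^sub>2 \<in> pullbacks\<^sub>2 d\<^sub>2" "f\<^sub>3 \<in> pullbacks\<^sub>3 d\<^sub>3"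
    by (rule pullback_sumsE[OF assms])
  then show ?thesis
    by (simp add: divisor_degree_add order finite_vertex_action.divisor_degree_pullback[OF generated_action])
qed

lemma pullback_sums_shift_degrees:
  assumes f: "f \<in> pullback_sums (int n * k\<^sub>1) (int n * k\<^sub>2) (- 2 * (k\<^sub>1 + k\<^sub>2))" and v: "v \<in> verts G"
  shows "f \<in> pullback_sums 0 0 0"
proof -
  let ?u = "\<Sum>g\<in>carrier D. point (\<phi> g v)"
  note u = all_translates_pullback[OF v]
  have "(- k\<^sub>1) *\<^sub>Z ?u + (- k\<^sub>2) *\<^sub>Z ?u + (k\<^sub>1 + k\<^sub>2) *\<^sub>Z ?u
      \<in> pullback_sums (- k\<^sub>1 * int n) (- k\<^sub>2 * int n) ((k\<^sub>1 + k\<^sub>2) * 2)"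
    by (intro pullback_sumsI pullbacks_deg_scale u)
  moreover have "(- k\<^sub>1) *\<^sub>Z ?u + (- k\<^sub>2) *\<^sub>Z ?u + (k\<^sub>1 + k\<^sub>2) *\<^sub>Z ?u = 0"
    by (simp add: fun_eq_iff algebra_simps)
  ultimately have "0 \<in> pullback_sums (- k\<^sub>1 * int n) (- k\<^sub>2 * int n) ((k\<^sub>1 + k\<^sub>2) * 2)" by simp
  from pullback_sums_add[OF f this] show ?thesis by (simp add: algebra_simps)
qed

definition all_pullbacks :: "('v \<Rightarrow> int) set" where
  "all_pullbacks = (\<Union>d\<^sub>1 d\<^sub>2 d\<^sub>3. pullback_sums d\<^sub>1 d\<^sub>2 d\<^sub>3)"

lemma mem_all_pullbacks_iff: "f \<in> all_pullbacks \<longleftrightarrow> (\<exists>d\<^sub>1 d\<^sub>2 d\<^sub>3. f \<in> pullback_sums d\<^sub>1 d\<^sub>2 d\<^sub>3)"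
  by (simp add: all_pullbacks_def)

lemma subspace_all_pullbacks: "int_fun.subspace all_pullbacks"
proof (rule int_fun.subspaceI)
  show "0 \<in> all_pullbacks"
    using subsetD[OF pullbacks_subset_sums(1) pullbacks_deg_zero] mem_all_pullbacks_iff by blast
  show "f + g \<in> all_pullbacks" if f: "f \<in> all_pullbacks" and g: "g \<in> all_pullbacks" for f g
  proof -
    obtain d\<^sub>1 d\<^sub>2 d\<^sub>3 where "f \<in> pullback_sums d\<^sub>1 d\<^sub>2 d\<^sub>3" using f mem_all_pullbacks_iff by blast
    moreover obtain e\<^sub>1 e\<^sub>2 e\<^sub>3 where "g \<in> pullback_sums e\<^sub>1 e\<^sub>2 e\<^sub>3" using g mem_all_pullbacks_iff by blast
    ultimately show ?thesis using pullback_sums_add mem_all_pullbacks_iff by blast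
  qed
  show "a *\<^sub>Z f \<in> all_pullbacks" if f: "f \<in> all_pullbacks" for a f
  proof -
    obtain d\<^sub>1 d\<^sub>2 d\<^sub>3 where "f \<in> pullback_sums d\<^sub>1 d\<^sub>2 d\<^sub>3" using f mem_all_pullbacks_iff by blast
    then show ?thesis using pullback_sums_scale mem_all_pullbacks_iff by blast
  qed
qed

lemmas all_pullbacks_add = int_fun.subspace_add[OF subspace_all_pullbacks]
  and all_pullbacks_diff = int_fun.subspace_diff[OF subspace_all_pullbacks]
  and all_pullbacks_scale = int_fun.subspace_scale[OF subspace_all_pullbacks]
  and all_pullbacks_sum = int_fun.subspace_sum[OF subspace_all_pullbacks]

lemma pullbacks_subset_all:
  "pullbacks\<^sub>1 d \<subseteq> all_pullbacks" "pullbacks\<^sub>2 d \<subseteq> all_pullbacks" "pullbacks\<^sub>3 d \<subseteq> all_pullbacks"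
proof -
  have "pullback_sums d\<^sub>1 d\<^sub>2 d\<^sub>3 \<subseteq> all_pullbacks" for d\<^sub>1 d\<^sub>2 d\<^sub>3
    using mem_all_pullbacks_iff by blast
  note sums = subset_trans[OF _ this]
  show "pullbacks\<^sub>1 d \<subseteq> all_pullbacks" "pullbacks\<^sub>2 d \<subseteq> all_pullbacks" "pullbacks\<^sub>3 d \<subseteq> all_pullbacks"
    by (rule sums[OF pullbacks_subset_sums(1)] sums[OF pullbacks_subset_sums(2)]
        sums[OF pullbacks_subset_sums(3)])+
qed

lemma reflected_points_mem:
  assumes "strand_pair p q"
  shows "point (p i) + point (q (1 - i)) \<in> all_pullbacks"
    and "point (p i) + point (q (2 - i)) \<in> all_pullbacks"
proof -
  note p = strand_pair_reflect[OF assms]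
  show "point (p i) + point (q (1 - i)) \<in> all_pullbacks"
    using reflection_pullback[OF reflections(1-3) p(1)] pullbacks_subset_all(1) p(2) by fastforce
  show "point (p i) + point (q (2 - i)) \<in> all_pullbacks"
    using reflection_pullback[OF reflections(4-6) p(1)] pullbacks_subset_all(2) p(3) by fastforce
qed

lemma strand_diff_mem:
  assumes pq: "strand_pair p q"
  shows "point (p i) - point (p k) \<in> all_pullbacks"
proof -
  have "point (p i) - point (p 0) \<in> all_pullbacks" for i
  proof (induction i rule: int_induct[where k=0])
    case base
    show ?case using int_fun.subspace_0[OF subspace_all_pullbacks] by (simp add: zero_fun_def)
  next
    have neighbours: "point (p (i + 1)) - point (p i) \<in> all_pullbacks" for i
      using all_pullbacks_diff[OF reflected_points_mem(2,1)[OF strand_pair_sym[OF pq], of "1 - i"]]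
      by (simp add: algebra_simps)
    {
      case (step1 i)
      show ?case using all_pullbacks_add[OF neighbours[of i] step1.IH] by (simp add: plus_fun_def)
    next
      case (step2 i)
      show ?case using all_pullbacks_diff[OF step2.IH neighbours[of "i - 1"]] by (simp add: fun_diff_def)
    }
  qed
  from all_pullbacks_diff[OF this[of i] this[of k]] show ?thesis by (simp add: fun_diff_def)
qed

lemma strand_sum_mem:
  assumes "strand_pair p q"
  shows "point (p i) + point (q k) \<in> all_pullbacks"
  using all_pullbacks_add[OF reflected_points_mem(1)[OF assms, of i]
      strand_diff_mem[OF strand_pair_sym[OF assms], of k "1 - i"]] by (simp add: algebra_simps)

lemma strand_multiple_mem:
  assumes pq: "strand_pair p q"
  shows "int n *\<^sub>Z point (p i) \<in> all_pullbacks"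
proof -
  let ?R = "carrier (subgroup_generated D {rotation})"
  have card_R: "card ?R = n"
    using order_dihedral_rotations[OF dihedral] by (simp add: order_def)
  have "point (p i) - point (\<phi> g (p i)) \<in> all_pullbacks" if "g \<in> ?R" for g
  proof -
    obtain k :: int where "g = rotation [^] k"
      using \<open>g \<in> ?R\<close> reflections by (auto simp: carrier_subgroup_generated_by_singleton)
    then show ?thesis by (simp add: rotation_pow_strand[OF pq] strand_diff_mem[OF pq])
  qed
  moreover have "(\<Sum>g\<in>?R. point (\<phi> g (p i))) \<in> all_pullbacks"
    using finite_vertex_action.translates_pullback[OF generated_action strand_pair_reflect(1)[OF pq]]
    by (rule subsetD[OF pullbacks_subset_all(3)])
  ultimately have
    "(\<Sum>g\<in>?R. point (p i) - point (\<phi> g (p i))) + (\<Sum>g\<in>?R. point (\<phi> g (p i))) \<in> all_pullbacks"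
    by (intro all_pullbacks_add[OF all_pullbacks_sum])
  moreover have "(\<Sum>g\<in>?R. point (p i) - point (\<phi> g (p i))) + (\<Sum>g\<in>?R. point (\<phi> g (p i))) = int n *\<^sub>Z point (p i)"
    by (simp add: sum_subtractf card_R fun_eq_iff)
  ultimately show ?thesis by simp
qed

lemma self_paired_strand_mem:
  assumes "strand_pair p p"
  shows "point (p i) \<in> all_pullbacks"
proof -
  obtain m where m: "n = 2 * m + 1" using odd_n by (rule oddE)
  have "int n *\<^sub>Z point (p i) - int m *\<^sub>Z (point (p i) + point (p i)) \<in> all_pullbacks"
    by (intro all_pullbacks_diff all_pullbacks_scale strand_multiple_mem[OF assms] strand_sum_mem[OF assms])
  moreover have "int n *\<^sub>Z point (p i) - int m *\<^sub>Z (point (p i) + point (p i)) = point (p i)"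
    by (simp add: m fun_eq_iff algebra_simps)
  ultimately show ?thesis by simp
qed

lemma balanced_strands_mem:
  assumes pq: "strand_pair p q"
    and balanced: "[(\<Sum>i\<in>I. f (p i)) = (\<Sum>i\<in>I. f (q i))] (mod int n)"
  shows "(\<Sum>i\<in>I. f (p i) *\<^sub>Z point (p i) + f (q i) *\<^sub>Z point (q i)) \<in> all_pullbacks"
proof -
  obtain m where m: "(\<Sum>i\<in>I. f (p i)) - (\<Sum>i\<in>I. f (q i)) = int n * m"
    using balanced by (auto simp: cong_iff_dvd_diff)
  let ?v = "point (p 0)"
  have "(\<Sum>i\<in>I. f (p i) *\<^sub>Z (point (p i) - ?v) + f (q i) *\<^sub>Z (?v + point (q i))) + m *\<^sub>Z int n *\<^sub>Z ?v
      \<in> all_pullbacks"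
    by (intro all_pullbacks_add all_pullbacks_sum all_pullbacks_scale strand_multiple_mem[OF pq]
        strand_diff_mem[OF pq] strand_sum_mem[OF pq])
  also have "(\<Sum>i\<in>I. f (p i) *\<^sub>Z (point (p i) - ?v) + f (q i) *\<^sub>Z (?v + point (q i))) + m *\<^sub>Z int n *\<^sub>Z ?v
      = (\<Sum>i\<in>I. f (p i) *\<^sub>Z point (p i) + f (q i) *\<^sub>Z point (q i))
        + (int n * m - ((\<Sum>i\<in>I. f (p i)) - (\<Sum>i\<in>I. f (q i)))) *\<^sub>Z ?v"
    by (simp add: fun_eq_iff sum_fun_apply algebra_simps sum.distrib sum_subtractf sum_distrib_left)
  finally show ?thesis by (simp add: m)
qed

end

section \<open>Labelled graphs\<close>

locale dihedral_labelled_graph = dihedral_vertex_action D G \<phi> n \<sigma>\<^sub>1 \<sigma>\<^sub>2 \<psi>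
  for D :: "('g, 'm) monoid_scheme" (structure) and G :: "('v, 'e) multigraph"
    and \<phi> n \<sigma>\<^sub>1 \<sigma>\<^sub>2 and \<psi> :: "'g \<Rightarrow> 'e \<Rightarrow> 'e" +
  fixes s t :: nat and z x y :: "int \<Rightarrow> nat \<Rightarrow> 'v"
  assumes orbit_sizes: "\<forall>B\<in>orbits D (verts G) \<phi>. card B = n \<or> card B = 2 * n"
    and labelling: "dihedral_labelling D n \<sigma>\<^sub>1 \<sigma>\<^sub>2 G \<phi> s t z x y"
begin

abbreviation z_orbit :: "nat \<Rightarrow> 'v set" where
  "z_orbit j \<equiv> (\<lambda>i. z i j) ` {1..int n}"

abbreviation xy_orbit :: "nat \<Rightarrow> 'v set" where
  "xy_orbit j \<equiv> (\<lambda>i. x i j) ` {1..int n} \<union> (\<lambda>i. y i j) ` {1..int n}"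

lemma bij_betw_z_orbit: "bij_betw z_orbit {1..s} {B \<in> orbits D (verts G) \<phi>. card B = n}"
  and bij_betw_xy_orbit: "bij_betw xy_orbit {1..t} {B \<in> orbits D (verts G) \<phi>. card B = 2 * n}"
  using labelling unfolding dihedral_labelling_def setcompr_eq_image Collect_mem_eq by blast+

lemma inj_on_z:
  assumes "j \<in> {1..s}"
  shows "inj_on (\<lambda>i. z i j) {1..int n}"
  using bij_betw_apply[OF bij_betw_z_orbit assms] by (auto intro: eq_card_imp_inj_on)

lemma inj_on_xy:
  assumes "j \<in> {1..t}"
  shows "inj_on (\<lambda>i. x i j) {1..int n}" "inj_on (\<lambda>i. y i j) {1..int n}"
    "(\<lambda>i. x i j) ` {1..int n} \<inter> (\<lambda>i. y i j) ` {1..int n} = {}"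
proof -
  let ?X = "(\<lambda>i. x i j) ` {1..int n}" and ?Y = "(\<lambda>i. y i j) ` {1..int n}"
  have "card ?X \<le> n" "card ?Y \<le> n"
    using card_image_le[of "{1..int n}"] by force+
  moreover have "card ?X + card ?Y = card (?X \<union> ?Y) + card (?X \<inter> ?Y)"
    by (rule card_Un_Int) auto
  moreover have "card (?X \<union> ?Y) = 2 * n"
    using bij_betw_apply[OF bij_betw_xy_orbit assms] by simp
  ultimately have "card ?X = n" "card ?Y = n" "card (?X \<inter> ?Y) = 0" by linarith+
  then show "inj_on (\<lambda>i. x i j) {1..int n}" "inj_on (\<lambda>i. y i j) {1..int n}" "?X \<inter> ?Y = {}"
    by (auto intro: eq_card_imp_inj_on)
qed

lemma strand_pair_z:
  assumes j: "j \<in> {1..s}"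
  shows "strand_pair (\<lambda>i. z i j) (\<lambda>i. z i j)"
proof (rule strand_pairI)
  show "z_orbit j \<subseteq> verts G"
    using bij_betw_apply[OF bij_betw_z_orbit j] orbits_coverture by blast
qed (use labelling j in \<open>simp_all add: dihedral_labelling_def periodic_fun_simple_def\<close>)

lemma strand_pair_xy:
  assumes j: "j \<in> {1..t}"
  shows "strand_pair (\<lambda>i. x i j) (\<lambda>i. y i j)"
proof (rule strand_pairI)
  show "(\<lambda>i. x i j) ` {1..int n} \<subseteq> verts G"
    using bij_betw_apply[OF bij_betw_xy_orbit j] orbits_coverture by blast
qed (use labelling j in \<open>simp_all add: dihedral_labelling_def periodic_fun_simple_def\<close>)

lemma sum_verts:
  fixes F :: "'v \<Rightarrow> 'b :: comm_monoid_add"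
  shows "(\<Sum>v\<in>verts G. F v) =
    (\<Sum>j=1..s. \<Sum>i=1..int n. F (z i j)) + (\<Sum>j=1..t. \<Sum>i=1..int n. F (x i j) + F (y i j))"
proof -
  let ?O = "orbits D (verts G) \<phi>" and ?sum = "\<lambda>B. \<Sum>v\<in>B. F v"
  let ?O\<^sub>1 = "{B \<in> ?O. card B = n}" and ?O\<^sub>2 = "{B \<in> ?O. card B = 2 * n}"
  have finite_orbits: "finite ?O" using finite_verts by (simp add: orbits_def)
  have split: "?O = ?O\<^sub>1 \<union> ?O\<^sub>2" using orbit_sizes by auto
  have "(\<Sum>v\<in>verts G. F v) = (\<Sum>B\<in>?O. ?sum B)"
    by (rule disjoint_sum[OF finite_verts, symmetric])
  also have "\<dots> = (\<Sum>B\<in>?O\<^sub>1. ?sum B) + (\<Sum>B\<in>?O\<^sub>2. ?sum B)"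
    by (subst split, rule sum.union_disjoint) (use finite_orbits n_pos in auto)
  also have "(\<Sum>B\<in>?O\<^sub>1. ?sum B) = (\<Sum>j=1..s. ?sum (z_orbit j))"
    by (rule sum.reindex_bij_betw[OF bij_betw_z_orbit, symmetric])
  also have "\<dots> = (\<Sum>j=1..s. \<Sum>i=1..int n. F (z i j))"
    using inj_on_z by (intro sum.cong refl) (simp add: sum.reindex)
  also have "(\<Sum>B\<in>?O\<^sub>2. ?sum B) = (\<Sum>j=1..t. ?sum (xy_orbit j))"
    by (rule sum.reindex_bij_betw[OF bij_betw_xy_orbit, symmetric])
  also have "\<dots> = (\<Sum>j=1..t. \<Sum>i=1..int n. F (x i j) + F (y i j))"
    using inj_on_xy by (intro sum.cong refl) (simp add: sum.union_disjoint sum.reindex sum.distrib)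
  finally show ?thesis .
qed

definition balanced :: "('v \<Rightarrow> int) \<Rightarrow> bool" where
  "balanced f \<longleftrightarrow> (\<forall>j\<in>{1..t}. [(\<Sum>i=1..int n. f (x i j)) = (\<Sum>i=1..int n. f (y i j))] (mod int n))"

lemma balanced_mem_all_pullbacks:
  assumes "f \<in> divisors G" and "balanced f"
  shows "f \<in> all_pullbacks"
proof -
  have "f = (\<Sum>v\<in>verts G. f v *\<^sub>Z point v)"
    using assms(1) by (simp add: sum_points_eq[OF finite_verts] divisors_def)
  also have "\<dots> = (\<Sum>j=1..s. \<Sum>i=1..int n. f (z i j) *\<^sub>Z point (z i j))
      + (\<Sum>j=1..t. \<Sum>i=1..int n. f (x i j) *\<^sub>Z point (x i j) + f (y i j) *\<^sub>Z point (y i j))"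
    by (rule sum_verts)
  also have "\<dots> \<in> all_pullbacks"
    using assms(2) unfolding balanced_def
    by (intro all_pullbacks_add all_pullbacks_sum all_pullbacks_scale
        self_paired_strand_mem[OF strand_pair_z] balanced_strands_mem[OF strand_pair_xy]) auto
  finally show ?thesis .
qed

section \<open>Weights of pullbacks\<close>

definition weight :: "('v \<Rightarrow> int) \<Rightarrow> int" where
  "weight f = (\<Sum>i=1..int n. i * ((\<Sum>j=1..t. f (x i j)) + (\<Sum>j=1..t. f (y i j)) + (\<Sum>j=1..s. f (z i j))))"

lemma weight_eq_moments:
  "weight f = (\<Sum>j=1..s. moment (int n) (\<lambda>i. f (z i j)))
     + (\<Sum>j=1..t. moment (int n) (\<lambda>i. f (x i j)) + moment (int n) (\<lambda>i. f (y i j)))"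
proof -
  have "(\<Sum>j\<in>J. moment (int n) (\<lambda>i. g i j)) = (\<Sum>i=1..int n. i * (\<Sum>j\<in>J. g i j))"
    for J :: "nat set" and g
    unfolding moment_def sum_distrib_left by (rule sum.swap)
  then show ?thesis by (simp add: weight_def distrib_left sum.distrib)
qed

lemma weight_add: "weight (f + g) = weight f + weight g"
  by (simp add: weight_def sum.distrib distrib_left)

lemma strand_moments_reflect:
  assumes "strand_pair p q" and reflect: "\<And>i. f (q (c - i)) = f (p i)"
  shows "[moment (int n) (\<lambda>i. f (p i)) + moment (int n) (\<lambda>i. f (q i)) = c * (\<Sum>i=1..int n. f (p i))] (mod int n)"
    and "(\<Sum>i=1..int n. f (q i)) = (\<Sum>i=1..int n. f (p i))"
proof -
  note q = periodic_on_strand[OF strand_pair_sym[OF assms(1)], of f]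
  show sums: "(\<Sum>i=1..int n. f (q i)) = (\<Sum>i=1..int n. f (p i))"
    using sum_periodic_reflect[OF q, of c] n_pos by (simp add: reflect)
  show "[moment (int n) (\<lambda>i. f (p i)) + moment (int n) (\<lambda>i. f (q i)) = c * (\<Sum>i=1..int n. f (p i))] (mod int n)"
    using moment_reflect[OF q, of c] n_pos by (simp add: reflect sums)
qed

lemma weight_reflect:
  assumes reflect: "\<And>p q i. strand_pair p q \<Longrightarrow> f (q (c - i)) = f (p i)"
  shows "[2 * weight f = c * divisor_degree G f] (mod int n)"
proof -
  let ?m = "\<lambda>p. moment (int n) (\<lambda>i. f (p i))" and ?S = "\<lambda>p. \<Sum>i=1..int n. f (p i)"
  have moments: "[?m p + ?m q = c * ?S p] (mod int n)" and sums: "?S q = ?S p" if "strand_pair p q" for p q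
    using strand_moments_reflect[OF that reflect[OF that]] .
  have "[2 * ?m (\<lambda>i. z i j) = c * ?S (\<lambda>i. z i j)] (mod int n)" if "j \<in> {1..s}" for j
    using moments[OF strand_pair_z[OF that]] by simp
  then have z_moments: "[(\<Sum>j=1..s. 2 * ?m (\<lambda>i. z i j)) = (\<Sum>j=1..s. c * ?S (\<lambda>i. z i j))] (mod int n)"
    by (rule cong_sum)
  have "[2 * (?m (\<lambda>i. x i j) + ?m (\<lambda>i. y i j)) = c * (?S (\<lambda>i. x i j) + ?S (\<lambda>i. y i j))] (mod int n)"
    if "j \<in> {1..t}" for j
    using cong_scalar_left[OF moments[OF strand_pair_xy[OF that]], of 2] sums[OF strand_pair_xy[OF that]]
    by (simp add: mult.left_commute)
  then have "[(\<Sum>j=1..t. 2 * (?m (\<lambda>i. x i j) + ?m (\<lambda>i. y i j)))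
      = (\<Sum>j=1..t. c * (?S (\<lambda>i. x i j) + ?S (\<lambda>i. y i j)))] (mod int n)"
    by (rule cong_sum)
  from cong_add[OF z_moments this] show ?thesis
    by (simp add: weight_eq_moments divisor_degree_def sum_verts distrib_left sum_distrib_left sum.distrib)
qed

lemma weight_pullback\<^sub>1:
  assumes f: "f \<in> pullbacks\<^sub>1 d"
  shows "[weight f = d] (mod int n)"
proof -
  have "[2 * weight f = 1 * divisor_degree G f] (mod int n)"
    by (rule weight_reflect) (rule pullback\<^sub>1_on_strands[OF _ f])
  also have "divisor_degree G f = 2 * d"
    using divisor_degree_pullback_sums subsetD[OF pullbacks_subset_sums(1) f] by fastforce
  finally show ?thesis using odd_n by (simp add: cong_double_iff)
qed

lemma weight_pullback\<^sub>2:
  assumes f: "f \<in> pullbacks\<^sub>2 d"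
  shows "[weight f = 2 * d] (mod int n)"
proof -
  have "[2 * weight f = 2 * divisor_degree G f] (mod int n)"
    by (rule weight_reflect) (rule pullback\<^sub>2_on_strands[OF _ f])
  also have "divisor_degree G f = 2 * d"
    using divisor_degree_pullback_sums subsetD[OF pullbacks_subset_sums(2) f] by fastforce
  finally show ?thesis using cong_double_iff[of "int n" "weight f" "2 * d"] odd_n by simp
qed

lemma weight_pullback\<^sub>3:
  assumes f: "f \<in> pullbacks\<^sub>3 d"
  shows "[weight f = 0] (mod int n)"
proof -
  have "[moment (int n) (\<lambda>i. f (p i)) = 0] (mod int n)" if "strand_pair p q" for p q
  proof -
    have "(\<lambda>i. f (p i)) = (\<lambda>_. f (p 0))" using pullback\<^sub>3_on_strands[OF that f] by blast
    then show ?thesis using moment_const[of "int n" "f (p 0)"] odd_n n_pos by simp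
  qed
  note zero = this[OF strand_pair_z] this[OF strand_pair_xy] this[OF strand_pair_sym[OF strand_pair_xy]]
  have "[weight f = (\<Sum>j=1..s. 0) + (\<Sum>j=1..t. 0 + 0)] (mod int n)"
    unfolding weight_eq_moments by (intro cong_add cong_sum zero)
  then show ?thesis by simp
qed

lemma weight_pullback_sums:
  assumes "f \<in> pullback_sums d\<^sub>1 d\<^sub>2 d\<^sub>3"
  shows "[weight f = d\<^sub>1 + 2 * d\<^sub>2] (mod int n)"
proof -
  obtain f\<^sub>1 f\<^sub>2 f\<^sub>3 where f: "f = f\<^sub>1 + f\<^sub>2 + f\<^sub>3" "f\<^sub>1 \<in> pullbacks\<^sub>1 d\<^sub>1" "f\<^sub>2 \<in> pullbacks\<^sub>2 d\<^sub>2" "f\<^sub>3 \<in> pullbacks\<^sub>3 d\<^sub>3"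
    by (rule pullback_sumsE[OF assms])
  have "[weight f\<^sub>1 + weight f\<^sub>2 + weight f\<^sub>3 = d\<^sub>1 + 2 * d\<^sub>2 + 0] (mod int n)"
    by (intro cong_add weight_pullback\<^sub>1[OF f(2)] weight_pullback\<^sub>2[OF f(3)] weight_pullback\<^sub>3[OF f(4)])
  then show ?thesis by (simp add: f(1) weight_add)
qed

lemma balanced_pullback_sums:
  assumes "f \<in> pullback_sums d\<^sub>1 d\<^sub>2 d\<^sub>3"
  shows "balanced f"
  unfolding balanced_def
proof
  fix j assume "j \<in> {1..t}"
  note xy = strand_pair_xy[OF this]
  obtain f\<^sub>1 f\<^sub>2 f\<^sub>3 where f: "f = f\<^sub>1 + f\<^sub>2 + f\<^sub>3" "f\<^sub>1 \<in> pullbacks\<^sub>1 d\<^sub>1" "f\<^sub>2 \<in> pullbacks\<^sub>2 d\<^sub>2" "f\<^sub>3 \<in> pullbacks\<^sub>3 d\<^sub>3"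
    by (rule pullback_sumsE[OF assms])
  have reflected: "[(\<Sum>i=1..int n. f\<^sub>1 (x i j)) = (\<Sum>i=1..int n. f\<^sub>1 (y i j))] (mod int n)"
    "[(\<Sum>i=1..int n. f\<^sub>2 (x i j)) = (\<Sum>i=1..int n. f\<^sub>2 (y i j))] (mod int n)"
    using strand_moments_reflect(2)[OF xy pullback\<^sub>1_on_strands[OF xy f(2)]]
      strand_moments_reflect(2)[OF xy pullback\<^sub>2_on_strands[OF xy f(3)]] by simp_all
  have "(\<Sum>i=1..int n. f\<^sub>3 (p i)) = int n * f\<^sub>3 (p 0)" if "strand_pair p q" for p q
  proof -
    have "(\<Sum>i=1..int n. f\<^sub>3 (p i)) = (\<Sum>i=1..int n. f\<^sub>3 (p 0))"
      by (rule sum.cong[OF refl pullback\<^sub>3_on_strands[OF that f(4)]])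
    then show ?thesis by simp
  qed
  from this[OF xy] this[OF strand_pair_sym[OF xy]]
  have "[(\<Sum>i=1..int n. f\<^sub>3 (x i j)) = (\<Sum>i=1..int n. f\<^sub>3 (y i j))] (mod int n)"
    by (simp add: cong_def)
  from cong_add[OF cong_add[OF reflected] this]
  show "[(\<Sum>i=1..int n. f (x i j)) = (\<Sum>i=1..int n. f (y i j))] (mod int n)"
    by (simp add: f(1) sum.distrib)
qed

theorem pullback_sum_iff:
  assumes "\<delta> \<in> divisors G" and "divisor_degree G \<delta> = 0" and "verts G \<noteq> {}"
  shows "\<delta> \<in> pullback_sum D \<sigma>\<^sub>1 \<sigma>\<^sub>2 G \<phi> \<psi> \<longleftrightarrow> [weight \<delta> = 0] (mod int n) \<and> balanced \<delta>"
  unfolding pullback_sum_eq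
proof
  assume "\<delta> \<in> pullback_sums 0 0 0"
  then show "[weight \<delta> = 0] (mod int n) \<and> balanced \<delta>"
    using weight_pullback_sums[of \<delta> 0 0 0] balanced_pullback_sums by simp
next
  assume conditions: "[weight \<delta> = 0] (mod int n) \<and> balanced \<delta>"
  then obtain d\<^sub>1 d\<^sub>2 d\<^sub>3 where \<delta>: "\<delta> \<in> pullback_sums d\<^sub>1 d\<^sub>2 d\<^sub>3"
    using balanced_mem_all_pullbacks[OF assms(1)] mem_all_pullbacks_iff by blast
  have "odd (int n)" using odd_n by simp
  moreover have "2 * d\<^sub>1 + 2 * d\<^sub>2 + int n * d\<^sub>3 = 0"
    using divisor_degree_pullback_sums[OF \<delta>] assms(2) by simp
  moreover have "[d\<^sub>1 + 2 * d\<^sub>2 = 0] (mod int n)"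
    using weight_pullback_sums[OF \<delta>] conditions cong_sym cong_trans by blast
  ultimately obtain k\<^sub>1 k\<^sub>2 where "d\<^sub>1 = int n * k\<^sub>1" "d\<^sub>2 = int n * k\<^sub>2" "d\<^sub>3 = - 2 * (k\<^sub>1 + k\<^sub>2)"
    by (rule degree_equations_solution)
  with \<delta> \<open>verts G \<noteq> {}\<close> show "\<delta> \<in> pullback_sums 0 0 0"
    using pullback_sums_shift_degrees by blast
qed

end

theorem theorem3p3:
  fixes D :: "('g, 'm) monoid_scheme" and n :: nat and \<sigma>\<^sub>1 \<sigma>\<^sub>2 :: 'g
    and G :: "('v, 'e) multigraph"
    and \<phi> :: "'g \<Rightarrow> 'v \<Rightarrow> 'v" and \<psi> :: "'g \<Rightarrow> 'e \<Rightarrow> 'e"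
    and s t :: nat and z x y :: "int \<Rightarrow> nat \<Rightarrow> 'v"
    and \<delta> :: "'v \<Rightarrow> int"
  assumes "odd n"
    and "dihedral_group D n \<sigma>\<^sub>1 \<sigma>\<^sub>2"
    and "finite_loopless_graph G" and "connected_graph G"
    and "harmonic_action D G \<phi> \<psi>"
    and "\<forall>B\<in>orbits D (verts G) \<phi>. card B = n \<or> card B = 2 * n"
    and "dihedral_labelling D n \<sigma>\<^sub>1 \<sigma>\<^sub>2 G \<phi> s t z x y"
    and "\<delta> \<in> divisors G" and "divisor_degree G \<delta> = 0"
  shows "\<delta> \<in> pullback_sum D \<sigma>\<^sub>1 \<sigma>\<^sub>2 G \<phi> \<psi> \<longleftrightarrow>
    [(\<Sum>i=1..int n. i * ((\<Sum>j=1..t. \<delta> (x i j)) + (\<Sum>j=1..t. \<delta> (y i j)) + (\<Sum>j=1..s. \<delta> (z i j)))) = 0]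
      (mod int n) \<and>
    (\<forall>j\<in>{1..t}. [(\<Sum>i=1..int n. \<delta> (x i j)) = (\<Sum>i=1..int n. \<delta> (y i j))] (mod int n))"
proof -
  interpret group_action D "verts G" \<phi>
    using assms(5) by (simp add: harmonic_action_def graph_action_def)
  interpret dihedral_labelled_graph D G \<phi> n \<sigma>\<^sub>1 \<sigma>\<^sub>2 \<psi> s t z x y
  proof
    show "finite (verts G)" using assms(3) by (simp add: finite_loopless_graph_def)
    show "finite (carrier D)"
      using assms(2) odd_pos[OF assms(1)]
      by (intro card_ge_0_finite) (simp add: dihedral_group_def order_def)
  qed (use assms in auto)
  have "verts G \<noteq> {}" using assms(4) by (simp add: connected_graph_def)
  from pullback_sum_iff[OF assms(8,9) this] show ?thesis
    unfolding weight_def balanced_def .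
qed

end
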